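(* For $d\in\mathbb N$, the OH noncommutative complex Euclidean $d$-ball, i.e. the graded set $\text{OH-Ball}_{\mathbb C}(d)$ of all $d$-tuples $\mathfrak c=(c_1,\dots,c_d)$ of complex $n\times n$ matrices ($n\in\mathbb N$) for which $\sum_{j=1}^d c_j^*c_j\le 1$, has Smith-Ward geometry.
   Context: $\mathbb B$ is the C$^*$-algebra of bounded linear operators on $\ell^2(\mathbb N)$ and $\mathbb K$ is the ideal of compact operators. For a $d$-tuple $\mathfrak x$ of elements of a unital C$^*$-algebra, $\mathcal O_{\mathfrak x}=\mathrm{Span}\{1,x_1,x_1^*,\dots,x_d,x_d^*\}$. The matrix range is $W(\mathfrak x)=\bigsqcup_n W_n(\mathfrak x)$, $W_n(\mathfrak x)=\{(\phi(x_1),\dots,\phi(x_d)) : \phi:\mathrm C^*(\mathcal O_{\mathfrak x})\to M_n(\mathbb C)\text{ unital completely positive}\}$. For $\mathfrak x\in\mathbb B^d$, the essential matrix range $W_{\rm e}(\mathfrak x)=\bigsqcup_n W_{n,{\rm e}}(\mathfrak x)$ is defined in the same way but using only those $\phi$ that vanish on every compact operator in $\mathrm C^*(\mathcal O_{\mathfrak x})$; it equals the matrix range of the image of $\mathfrak x$ in $\mathbb B/\mathbb K$. A tuple $\mathfrak x\in\mathbb B^d$ has the Smith-Ward property if $W_{\rm e}(\mathfrak x)=W(\mathfrak x+\mathfrak k)$ for some $\mathfrak k\in\mathbb K^d$. A compact matrix convex set is a graded set $K_{\rm nc}=\bigsqcup_n K_n$, $K_n\subseteq M_n(\mathbb C)^d$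 compact, such that $\sum_{j=1}^m\gamma_j^*\mathfrak a_j\gamma_j\in K_n$ whenever $\mathfrak a_j\in K_{n_j}$ and $\gamma_j:\mathbb C^n\to\mathbb C^{n_j}$ are linear with $\sum_j\gamma_j^*\gamma_j=1_n$. It has Smith-Ward geometry if every tuple $\mathfrak x\in\mathbb B^d$ with $W_{\rm e}(\mathfrak x)=K_{\rm nc}$ has the Smith-Ward property. *)

theory Defs
  imports
    "HOL-Analysis.Analysis"
    "Jordan_Normal_Form.Schur_Decomposition"
begin

no_notation Finite_Cartesian_Product.vec_nth (infixl \<open>$\<close> 90)
no_notation Inner_Product.real_inner_class.inner (infix \<open>\<bullet>\<close> 70)

section \<open>The Hilbert space of square-summable sequences\<close>

typedef ell2 = "{f :: nat \<Rightarrow> complex. summable (\<lambda>n. (cmod (f n))\<^sup>2)}"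
  morphisms seq_of Abs_ell2
  by (rule exI[of _ "\<lambda>_. 0"]) simp

setup_lifting type_definition_ell2

lemma summable_square_add:
  fixes f g :: "nat \<Rightarrow> complex"
  assumes "summable (\<lambda>n. (cmod (f n))\<^sup>2)" "summable (\<lambda>n. (cmod (g n))\<^sup>2)"
  shows "summable (\<lambda>n. (cmod (f n + g n))\<^sup>2)"
proof (rule summable_comparison_test')
  show "summable (\<lambda>n. 2 * (cmod (f n))\<^sup>2 + 2 * (cmod (g n))\<^sup>2)"
    using assms by (intro summable_add summable_mult)
  fix n
  have "(cmod (f n + g n))\<^sup>2 \<le> (cmod (f n) + cmod (g n))\<^sup>2"
    by (intro power_mono norm_triangle_ineq) simp
  also have "\<dots> \<le> 2 * (cmod (f n))\<^sup>2 + 2 * (cmod (g n))\<^sup>2"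
    using sum_squares_bound[of "cmod (f n)" "cmod (g n)"] by (simp add: power2_sum)
  finally show "norm ((cmod (f n + g n))\<^sup>2) \<le> 2 * (cmod (f n))\<^sup>2 + 2 * (cmod (g n))\<^sup>2"
    by simp
qed

lemma summable_square_scale:
  fixes f :: "nat \<Rightarrow> complex"
  assumes "summable (\<lambda>n. (cmod (f n))\<^sup>2)"
  shows "summable (\<lambda>n. (cmod (c * f n))\<^sup>2)"
  using summable_mult[OF assms, of "(cmod c)\<^sup>2"] by (simp add: norm_mult power_mult_distrib)

lemma summable_mult_cnj:
  fixes f g :: "nat \<Rightarrow> complex"
  assumes "summable (\<lambda>n. (cmod (f n))\<^sup>2)" "summable (\<lambda>n. (cmod (g n))\<^sup>2)"
  shows "summable (\<lambda>n. f n * cnj (g n))"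
proof (rule summable_comparison_test')
  show "summable (\<lambda>n. (cmod (f n))\<^sup>2 + (cmod (g n))\<^sup>2)"
    using assms by (rule summable_add)
  fix n
  have "2 * (cmod (f n) * cmod (g n)) \<le> (cmod (f n))\<^sup>2 + (cmod (g n))\<^sup>2"
    using sum_squares_bound[of "cmod (f n)" "cmod (g n)"] by simp
  moreover have "0 \<le> cmod (f n) * cmod (g n)" by simp
  ultimately show "norm (f n * cnj (g n)) \<le> (cmod (f n))\<^sup>2 + (cmod (g n))\<^sup>2"
    unfolding norm_mult complex_mod_cnj by linarith
qed

instantiation ell2 :: real_vector
begin

lift_definition zero_ell2 :: ell2 is "\<lambda>_. 0" by simp

lift_definition plus_ell2 :: "ell2 \<Rightarrow> ell2 \<Rightarrow> ell2" is "\<lambda>f g n. f n + g n"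
  by (rule summable_square_add)

lift_definition uminus_ell2 :: "ell2 \<Rightarrow> ell2" is "\<lambda>f n. - f n" by simp

lift_definition minus_ell2 :: "ell2 \<Rightarrow> ell2 \<Rightarrow> ell2" is "\<lambda>f g n. f n - g n"
  subgoal for f g using summable_square_add[of f "\<lambda>n. - g n"] by simp
  done

lift_definition scaleR_ell2 :: "real \<Rightarrow> ell2 \<Rightarrow> ell2" is "\<lambda>r f n. complex_of_real r * f n"
  by (rule summable_square_scale)

instance
  by standard (transfer; auto simp: algebra_simps)+

end

lift_definition scaleC :: "complex \<Rightarrow> ell2 \<Rightarrow> ell2" (infixr \<open>*\<^sub>C\<close> 75)
  is "\<lambda>c f n. c * f n"
  by (rule summable_square_scale)

text \<open>Linear in the first and conjugate-linear in the second argument, in agreement with the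
  inner product \<open>\<bullet>c\<close> of complex column vectors.\<close>

lift_definition cinner :: "ell2 \<Rightarrow> ell2 \<Rightarrow> complex"
  is "\<lambda>f g. \<Sum>n. f n * cnj (g n)" .

instantiation ell2 :: real_inner
begin

definition inner_ell2 :: "ell2 \<Rightarrow> ell2 \<Rightarrow> real"
  where "inner_ell2 x y = Re (cinner x y)"

lift_definition norm_ell2 :: "ell2 \<Rightarrow> real" is "\<lambda>f. sqrt (\<Sum>n. (cmod (f n))\<^sup>2)" .

definition dist_ell2 :: "ell2 \<Rightarrow> ell2 \<Rightarrow> real"
  where "dist_ell2 x y = norm (x - y)"

definition sgn_ell2 :: "ell2 \<Rightarrow> ell2"
  where "sgn_ell2 x = x /\<^sub>R norm x"

definition uniformity_ell2 :: "(ell2 \<times> ell2) filter"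
  where "uniformity_ell2 = (INF e\<in>{0<..}. principal {(x, y). dist x y < e})"

definition open_ell2 :: "ell2 set \<Rightarrow> bool"
  where "open_ell2 U \<longleftrightarrow> (\<forall>x\<in>U. eventually (\<lambda>(x', y). x' = x \<longrightarrow> y \<in> U) uniformity)"

instance
proof
  fix x y z :: ell2 and r :: real
  have re: "Re (cinner u v) = (\<Sum>n. Re (seq_of u n * cnj (seq_of v n)))" for u v
    unfolding cinner.rep_eq
    by (intro Re_suminf summable_mult_cnj) (use seq_of in auto)
  have sm: "summable (\<lambda>n. Re (seq_of u n * cnj (seq_of v n)))" for u v
    by (intro summable_Re summable_mult_cnj) (use seq_of in auto)
  have sq: "Re (seq_of u n * cnj (seq_of u n)) = (cmod (seq_of u n))\<^sup>2" for u n
    by (simp add: complex_mult_cnj cmod_power2)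
  have self: "inner u u = (\<Sum>n. (cmod (seq_of u n))\<^sup>2)" for u
    unfolding inner_ell2_def re sq ..
  have summ: "summable (\<lambda>n. (cmod (seq_of u n))\<^sup>2)" for u
    using seq_of[of u] by simp
  show "dist x y = norm (x - y)" by (rule dist_ell2_def)
  show "sgn x = x /\<^sub>R norm x" by (rule sgn_ell2_def)
  show "uniformity = (INF e\<in>{0<..}. principal {(x::ell2, y). dist x y < e})"
    by (rule uniformity_ell2_def)
  show "open U \<longleftrightarrow> (\<forall>x\<in>U. eventually (\<lambda>(x', y). x' = x \<longrightarrow> y \<in> U) uniformity)" for U :: "ell2 set"
    by (rule open_ell2_def)
  show "inner x y = inner y x"
    unfolding inner_ell2_def re by (simp add: algebra_simps)
  show "inner (x + y) z = inner x z + inner y z"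
    unfolding inner_ell2_def re
    by (subst suminf_add[OF sm sm]) (simp add: plus_ell2.rep_eq algebra_simps)
  show "inner (r *\<^sub>R x) y = r * inner x y"
    unfolding inner_ell2_def re
    by (subst suminf_mult[OF sm, symmetric]) (simp add: scaleR_ell2.rep_eq algebra_simps)
  show "0 \<le> inner x x"
    unfolding self by (intro suminf_nonneg summ) simp
  show "inner x x = 0 \<longleftrightarrow> x = 0"
    unfolding self suminf_eq_zero_iff[OF summ zero_le_power2]
    by (auto simp: zero_ell2.rep_eq seq_of_inject[symmetric])
  show "norm x = sqrt (inner x x)"
    unfolding self norm_ell2.rep_eq ..
qed

end

section \<open>Bounded operators, compact operators, and generated C*-algebras\<close>

text \<open>The library type \<open>ell2 \<Rightarrow>\<^sub>L ell2\<close> consists of the bounded real-linear maps, with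
  the operator norm; bounded operators are the complex-linear ones among them.\<close>

type_synonym opr = "ell2 \<Rightarrow>\<^sub>L ell2"

definition bounded_ops :: "opr set" (\<open>\<bbbB>\<close>)
  where "\<bbbB> = {T. \<forall>c x. blinfun_apply T (c *\<^sub>C x) = c *\<^sub>C blinfun_apply T x}"

definition compact_ops :: "opr set" (\<open>\<bbbK>\<close>)
  where "\<bbbK> = {T \<in> \<bbbB>. compact (closure (blinfun_apply T ` cball 0 1))}"

lemma norm_scaleC: "norm (c *\<^sub>C x) = cmod c * norm x"
proof -
  have "summable (\<lambda>n. (cmod (seq_of x n))\<^sup>2)" using seq_of[of x] by simp
  from suminf_mult[OF this, of "(cmod c)\<^sup>2"] show ?thesis
    by (simp add: norm_ell2.rep_eq scaleC.rep_eq norm_mult power_mult_distrib real_sqrt_mult)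
qed

lemma bounded_linear_scaleC: "bounded_linear (\<lambda>x. c *\<^sub>C x)"
proof (rule bounded_linear_intro[where K = "cmod c"])
  show "c *\<^sub>C (x + y) = c *\<^sub>C x + c *\<^sub>C y" for x y
    by transfer (auto simp: algebra_simps)
  show "c *\<^sub>C (r *\<^sub>R x) = r *\<^sub>R (c *\<^sub>C x)" for r x
    by transfer (auto simp: algebra_simps)
  show "norm (c *\<^sub>C x) \<le> norm x * cmod c" for x
    by (simp add: norm_scaleC)
qed

definition scaleC_op :: "complex \<Rightarrow> opr \<Rightarrow> opr" (infixr \<open>*\<^sub>O\<close> 75)
  where "c *\<^sub>O T = Blinfun (\<lambda>x. c *\<^sub>C blinfun_apply T x)"

lemma scaleC_op_apply [simp]: "blinfun_apply (c *\<^sub>O T) x = c *\<^sub>C blinfun_apply T x"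
  unfolding scaleC_op_def
  by (subst bounded_linear_Blinfun_apply)
    (auto intro: bounded_linear_compose[OF bounded_linear_scaleC] blinfun.bounded_linear_right)

interpretation op_space: vector_space scaleC_op
  by standard (rule blinfun_eqI, simp add: blinfun.add_left,
    (transfer; auto simp: algebra_simps))+

text \<open>Every bounded operator has a unique adjoint (Riesz), so the description is proper on
  \<open>\<bbbB>\<close>.\<close>

definition adj :: "opr \<Rightarrow> opr"
  where "adj T = (THE S. \<forall>x y. cinner (blinfun_apply S x) y = cinner x (blinfun_apply T y))"

definition cstar_subalgebra :: "opr set \<Rightarrow> bool"
  where "cstar_subalgebra A \<longleftrightarrow>
    A \<subseteq> \<bbbB> \<and> id_blinfun \<in> A \<and>
    (\<forall>S\<in>A. \<forall>T\<in>A. S + T \<in> A \<and> S o\<^sub>L T \<in> A) \<and>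
    (\<forall>c. \<forall>T\<in>A. c *\<^sub>O T \<in> A) \<and>
    (\<forall>T\<in>A. adj T \<in> A) \<and>
    closed A"

definition op_system :: "('d \<Rightarrow> opr) \<Rightarrow> opr set"
  where "op_system x = op_space.span (insert id_blinfun (range x \<union> range (\<lambda>j. adj (x j))))"

definition cstar :: "opr set \<Rightarrow> opr set"
  where "cstar S = cstar_subalgebra hull S"

section \<open>Unital completely positive maps into matrix algebras\<close>

text \<open>The array \<open>a i j\<close> with \<open>i, j < m\<close>, regarded as an operator on the direct sum of \<open>m\<close> copies
  of the Hilbert space, is positive. The order on complex numbers is the library's: \<open>0 \<le> z\<close> means
  that \<open>z\<close> is real and nonnegative.\<close>

definition op_matrix_pos :: "nat \<Rightarrow> (nat \<Rightarrow> nat \<Rightarrow> opr) \<Rightarrow> bool"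
  where "op_matrix_pos m a \<longleftrightarrow>
    (\<forall>h. 0 \<le> (\<Sum>i<m. \<Sum>j<m. cinner (blinfun_apply (a i j) (h j)) (h i)))"

text \<open>The same for an \<open>m \<times> m\<close> array of complex \<open>n \<times> n\<close> matrices.\<close>

definition block_matrix_pos :: "nat \<Rightarrow> nat \<Rightarrow> (nat \<Rightarrow> nat \<Rightarrow> complex mat) \<Rightarrow> bool"
  where "block_matrix_pos m n b \<longleftrightarrow>
    (\<forall>v. (\<forall>i<m. v i \<in> carrier_vec n) \<longrightarrow>
      0 \<le> (\<Sum>i<m. \<Sum>j<m. (b i j *\<^sub>v v j) \<bullet>c v i))"

definition ucp :: "opr set \<Rightarrow> nat \<Rightarrow> (opr \<Rightarrow> complex mat) \<Rightarrow> bool"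
  where "ucp A n \<phi> \<longleftrightarrow>
    (\<forall>a\<in>A. \<phi> a \<in> carrier_mat n n) \<and>
    (\<forall>a\<in>A. \<forall>b\<in>A. \<phi> (a + b) = \<phi> a + \<phi> b) \<and>
    (\<forall>c. \<forall>a\<in>A. \<phi> (c *\<^sub>O a) = c \<cdot>\<^sub>m \<phi> a) \<and>
    \<phi> id_blinfun = 1\<^sub>m n \<and>
    (\<forall>m a. (\<forall>i<m. \<forall>j<m. a i j \<in> A) \<and> op_matrix_pos m a \<longrightarrow>
      block_matrix_pos m n (\<lambda>i j. \<phi> (a i j)))"

section \<open>Matrix ranges\<close>

text \<open>A \<open>d\<close>-tuple is a function on a finite index type with \<open>d\<close> elements. A graded set is the
  disjoint union of its levels, that is, a set of pairs of a level \<open>n \<ge> 1\<close> and a tuple of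
  \<open>n \<times> n\<close> matrices.\<close>

type_synonym 'd graded = "(nat \<times> ('d \<Rightarrow> complex mat)) set"

definition level :: "'d graded \<Rightarrow> nat \<Rightarrow> ('d \<Rightarrow> complex mat) set"
  where "level K n = {a. (n, a) \<in> K}"

definition matrix_range :: "('d \<Rightarrow> opr) \<Rightarrow> 'd graded"
  where "matrix_range x =
    (SIGMA n:{1..}. {\<lambda>j. \<phi> (x j) | \<phi>. ucp (cstar (op_system x)) n \<phi>})"

definition ess_matrix_range :: "('d \<Rightarrow> opr) \<Rightarrow> 'd graded"
  where "ess_matrix_range x =
    (SIGMA n:{1..}. {\<lambda>j. \<phi> (x j) | \<phi>. ucp (cstar (op_system x)) n \<phi> \<and>
      (\<forall>a \<in> cstar (op_system x) \<inter> \<bbbK>. \<phi> a = 0\<^sub>m n n)})"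

definition smith_ward_property :: "('d \<Rightarrow> opr) \<Rightarrow> bool"
  where "smith_ward_property x \<longleftrightarrow>
    (\<exists>k. (\<forall>j. k j \<in> \<bbbK>) \<and> ess_matrix_range x = matrix_range (\<lambda>j. x j + k j))"

section \<open>Compact matrix convex sets and Smith-Ward geometry\<close>

definition mat_sum :: "nat \<Rightarrow> ('i \<Rightarrow> complex mat) \<Rightarrow> 'i set \<Rightarrow> complex mat"
  where "mat_sum n f I = mat n n (\<lambda>(r, s). \<Sum>i\<in>I. f i $$ (r, s))"

definition mat_le :: "nat \<Rightarrow> complex mat \<Rightarrow> complex mat \<Rightarrow> bool"
  where "mat_le n A B \<longleftrightarrow> (\<forall>v\<in>carrier_vec n. 0 \<le> ((B - A) *\<^sub>v v) \<bullet>c v)"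

text \<open>The type of matrices carries no topology, so compactness of a set of tuples of
  \<open>n \<times> n\<close> matrices is expressed through their entries, in the product topology. All coordinates
  outside the range \<open>r, s < n\<close> are set to \<open>0\<close>, so that only finitely many coordinates vary and the
  topology is the Euclidean one.\<close>

definition mat_entries :: "nat \<Rightarrow> ('d \<Rightarrow> complex mat) \<Rightarrow> 'd \<Rightarrow> nat \<Rightarrow> nat \<Rightarrow> complex"
  where "mat_entries n a = (\<lambda>j r s. if r < n \<and> s < n then a j $$ (r, s) else 0)"

definition compact_matrix_convex :: "'d graded \<Rightarrow> bool"
  where "compact_matrix_convex K \<longleftrightarrow>
    (\<forall>(n, a) \<in> K. 1 \<le> n \<and> (\<forall>j. a j \<in> carrier_mat n n)) \<and>
    (\<forall>n\<ge>1. compact (mat_entries n ` level K n)) \<and>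
    (\<forall>n\<ge>1. \<forall>(m::nat) N a \<gamma>.
      (\<forall>i<m. a i \<in> level K (N i) \<and> \<gamma> i \<in> carrier_mat (N i) n) \<and>
      mat_sum n (\<lambda>i. mat_adjoint (\<gamma> i) * \<gamma> i) {..<m} = 1\<^sub>m n \<longrightarrow>
      (\<lambda>j. mat_sum n (\<lambda>i. mat_adjoint (\<gamma> i) * a i j * \<gamma> i) {..<m}) \<in> level K n)"

definition smith_ward_geometry :: "'d graded \<Rightarrow> bool"
  where "smith_ward_geometry K \<longleftrightarrow>
    compact_matrix_convex K \<and>
    (\<forall>x. (\<forall>j. x j \<in> \<bbbB>) \<and> ess_matrix_range x = K \<longrightarrow> smith_ward_property x)"

definition OH_Ball :: "('d::finite) graded"
  where "OH_Ball =
    (SIGMA n:{1..}. {c. (\<forall>j. c j \<in> carrier_mat n n) \<and>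
      mat_le n (mat_sum n (\<lambda>j. mat_adjoint (c j) * c j) UNIV) (1\<^sub>m n)})"

end

theory Submission
  imports Defs
begin

text \<open>
  Let \<open>x\<close> have the ball as its essential matrix range, and let \<open>A = (\<Sum>\<^sub>j x\<^sub>j\<^sup>* x\<^sub>j) - 1\<close>, with positive
  part \<open>R\<close>. If \<open>R\<close> were not compact, there would be a bounded weakly null sequence \<open>\<xi>\<close> on which the
  form of \<open>A\<close> is bounded below by some \<open>\<delta> > 0\<close>. Compressing operators, in the limit along a suitable
  filter, to the span of \<open>\<xi>\<close> and the \<open>x\<^sub>j \<xi>\<close> is then a unital completely positive map that kills the
  compact operators and takes \<open>x\<close> out of the ball. So \<open>R\<close> is compact, and with
  \<open>G = (1 + R)\<inverse>\<close>, which lies in the C*-algebra of \<open>x\<close>, the tuple \<open>y\<^sub>j = x\<^sub>j G\<close> is a compact perturbation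
  of \<open>x\<close> with \<open>\<Sum>\<^sub>j y\<^sub>j\<^sup>* y\<^sub>j \<le> 1\<close>. The latter places the matrix range of \<open>y\<close> inside the ball. Conversely,
  maps that kill the compact operators do not distinguish \<open>x\<close> from \<open>y\<close>, and they restrict to the
  C*-algebra of \<open>y\<close>.
\<close>

section \<open>Positive operators on a real Hilbert space\<close>

text \<open>The C*-algebra of \<open>x\<close> dictates the tools. A map in the essential matrix
  range is given only there and vanishes only on the compact operators in it, so the perturbation
  has to lie in it, and with it \<open>R\<close> and \<open>G\<close>. Both are therefore limits of
  iterations with real coefficients, and both come with the clause that every closed unital algebra
  containing the input contains the output. The filter must make all bounded sequences converge at
  once, because the limit compression has to be defined on the whole algebra. A compression could
  shorten the vectors \<open>x\<^sub>j \<xi>\<close>; this is why they are included in the span,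
  where their norms survive in the limit. The power -1/2 of \<open>1 + R\<close> would be the
  natural factor for turning \<open>x\<close> into a column contraction. The inverse also gives one,
  and it is obtained from a single fixed point rather than from a further square root.\<close>

definition oper_algebra :: "('a::real_normed_vector \<Rightarrow>\<^sub>L 'a) set \<Rightarrow> bool" where
  "oper_algebra C \<longleftrightarrow> closed C \<and> id_blinfun \<in> C \<and>
    (\<forall>S\<in>C. \<forall>T\<in>C. S + T \<in> C \<and> S o\<^sub>L T \<in> C) \<and> (\<forall>r. \<forall>T\<in>C. r *\<^sub>R T \<in> C)"

lemma oper_algebraD:
  assumes "oper_algebra C"
  shows "closed C" "id_blinfun \<in> C"
    "S \<in> C \<Longrightarrow> T \<in> C \<Longrightarrow> S + T \<in> C" "S \<in> C \<Longrightarrow> T \<in> C \<Longrightarrow> S o\<^sub>L T \<in> C"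
    "T \<in> C \<Longrightarrow> r *\<^sub>R T \<in> C" "S \<in> C \<Longrightarrow> T \<in> C \<Longrightarrow> S - T \<in> C"
proof -
  have *: "S - T = S + (-1) *\<^sub>R T" by simp
  show "S \<in> C \<Longrightarrow> T \<in> C \<Longrightarrow> S - T \<in> C"
    unfolding * using assms unfolding oper_algebra_def by blast
qed (use assms in \<open>auto simp: oper_algebra_def\<close>)

section \<open>Square roots of operators by iteration\<close>

lemma tendsto_blinfun_compose:
  fixes f :: "_ \<Rightarrow> 'a::real_normed_vector \<Rightarrow>\<^sub>L 'a"
  assumes "(f \<longlongrightarrow> S) F" "(g \<longlongrightarrow> T) F"
  shows "((\<lambda>n. f n o\<^sub>L g n) \<longlongrightarrow> S o\<^sub>L T) F"
  using bounded_bilinear.tendsto[OF bounded_bilinear_blinfun_compose assms] .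

lemmas blinfun_simps = blinfun.add_left blinfun.diff_left blinfun.minus_left blinfun.scaleR_left
  blinfun.add_right blinfun.diff_right blinfun.scaleR_right blinfun.minus_right

text \<open>The equation for \<open>Y\<close> says \<open>(1 - Y)\<^sup>2 = 1 - T\<close>, so
  \<open>1 - Y\<close> is a square root. The same iteration for the number 1, the sequence
  \<open>s\<close>, increases and stays below 1, and it dominates both the norms and the increments
  of \<open>Y n\<close>; hence \<open>Y n\<close> is Cauchy. The second conclusion is an induction
  principle for the limit, by which symmetry, commutation, order bounds and membership in algebras
  are read off later.\<close>

lemma blinfun_sqrt_iteration:
  fixes T :: "'a::banach \<Rightarrow>\<^sub>L 'a"
  assumes T: "norm T \<le> 1"
  obtains Y where "Y = (1/2) *\<^sub>R (T + (Y o\<^sub>L Y))"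
    "\<And>P. closed P \<Longrightarrow> 0 \<in> P \<Longrightarrow> (\<And>Z. Z \<in> P \<Longrightarrow> (1/2) *\<^sub>R (T + (Z o\<^sub>L Z)) \<in> P) \<Longrightarrow> Y \<in> P"
proof -
  define Y where "Y n = ((\<lambda>Z. (1/2) *\<^sub>R (T + (Z o\<^sub>L Z))) ^^ n) 0" for n
  define s :: "nat \<Rightarrow> real" where "s n = ((\<lambda>z. (1 + z * z) / 2) ^^ n) 0" for n
  have Y0: "Y 0 = 0" and s0: "s 0 = 0" by (simp_all add: Y_def s_def)
  have YS: "Y (Suc n) = (1/2) *\<^sub>R (T + (Y n o\<^sub>L Y n))" for n by (simp add: Y_def)
  have sS: "s (Suc n) = (1 + s n * s n) / 2" for n by (simp add: s_def)
  have s01: "0 \<le> s n \<and> s n \<le> 1" for n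
  proof (induction n)
    case (Suc n)
    then have "s n * s n \<le> 1 * 1" by (intro mult_mono) auto
    moreover have "0 \<le> s n * s n" by (rule zero_le_square)
    ultimately show ?case unfolding sS by auto
  qed (simp add: s0)
  have nY: "norm (Y n) \<le> s n" for n
  proof (induction n)
    case (Suc n)
    have "norm (Y n o\<^sub>L Y n) \<le> s n * s n"
      by (rule order_trans[OF norm_blinfun_compose]) (intro mult_mono Suc, use s01 in auto)
    then have "norm (T + (Y n o\<^sub>L Y n)) \<le> 1 + s n * s n"
      using T norm_triangle_ineq[of T "Y n o\<^sub>L Y n"] by linarith
    then show ?case by (simp add: YS sS)
  qed (simp add: Y0 s0)
  have d: "norm (Y (Suc n) - Y n) \<le> s (Suc n) - s n" for n
  proof (induction n)
    case 0
    then show ?case using T by (simp add: YS sS Y0 s0)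
  next
    case (Suc n)
    let ?D = "Y (Suc n) - Y n"
    \<comment> \<open>The difference of the two squares is split in a way that is valid without
      commutation.\<close>
    have "Y (Suc (Suc n)) - Y (Suc n) = (1/2) *\<^sub>R ((Y (Suc n) o\<^sub>L ?D) + (?D o\<^sub>L Y n))"
      by (subst (1 2) YS) (rule blinfun_eqI, simp add: blinfun_simps algebra_simps)
    also have "norm \<dots> \<le> (1/2) * (s (Suc n) * (s (Suc n) - s n) + (s (Suc n) - s n) * s n)"
    proof -
      have "norm (Y (Suc n) o\<^sub>L ?D) \<le> s (Suc n) * (s (Suc n) - s n)"
        by (rule order_trans[OF norm_blinfun_compose]) (intro mult_mono Suc nY, use s01 in auto)
      moreover have "norm (?D o\<^sub>L Y n) \<le> (s (Suc n) - s n) * s n"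
        by (rule order_trans[OF norm_blinfun_compose], intro mult_mono Suc nY)
          (use s01 order_trans[OF norm_ge_zero Suc] in auto)
      ultimately have "norm ((Y (Suc n) o\<^sub>L ?D) + (?D o\<^sub>L Y n)) \<le>
         s (Suc n) * (s (Suc n) - s n) + (s (Suc n) - s n) * s n"
        using norm_triangle_ineq[of "Y (Suc n) o\<^sub>L ?D" "?D o\<^sub>L Y n"] by linarith
      then show ?thesis by simp
    qed
    also have "\<dots> = s (Suc (Suc n)) - s (Suc n)"
      by (simp only: sS[of "Suc n"] sS[of n]) (simp add: field_simps)
    finally show ?case .
  qed
  have inc: "incseq s"
    by (rule incseq_SucI) (use d order_trans[OF norm_ge_zero d] in auto)
  have dd: "norm (Y (n + k) - Y n) \<le> s (n + k) - s n" for n k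
  proof (induction k)
    case (Suc k)
    have "norm (Y (n + Suc k) - Y n) \<le> norm (Y (Suc (n+k)) - Y (n+k)) + norm (Y (n+k) - Y n)"
      using norm_triangle_ineq[of "Y (Suc (n+k)) - Y (n+k)" "Y (n+k) - Y n"] by simp
    then show ?case using Suc d[of "n+k"] by simp
  qed simp
  have "Cauchy s"
    using incseq_convergent[OF inc, of 1] s01 by (metis LIMSEQ_imp_Cauchy)
  have "Cauchy Y"
  proof (rule metric_CauchyI)
    fix e :: real assume "0 < e"
    then obtain M where M: "\<And>m n. m \<ge> M \<Longrightarrow> n \<ge> M \<Longrightarrow> dist (s m) (s n) < e"
      using \<open>Cauchy s\<close> unfolding Cauchy_def by blast
    have *: "dist (Y m) (Y n) < e" if "n \<ge> M" "m \<ge> n" for m n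
    proof -
      have "dist (Y m) (Y n) \<le> s m - s n"
        using dd[of n "m - n"] that by (simp add: dist_norm)
      also have "\<dots> \<le> dist (s m) (s n)" by (simp add: dist_real_def)
      also have "\<dots> < e" using M that by auto
      finally show ?thesis .
    qed
    show "\<exists>M. \<forall>m\<ge>M. \<forall>n\<ge>M. dist (Y m) (Y n) < e"
      by (rule exI[of _ M]) (metis * dist_commute linear)
  qed
  then obtain L where L: "Y \<longlonglongrightarrow> L" using Cauchy_convergent convergent_def by blast
  show thesis
  proof
    have "(\<lambda>n. Y (Suc n)) \<longlonglongrightarrow> L" using L by (rule LIMSEQ_Suc)
    moreover have "(\<lambda>n. Y (Suc n)) \<longlonglongrightarrow> (1/2) *\<^sub>R (T + (L o\<^sub>L L))"
      unfolding YS by (intro tendsto_intros tendsto_blinfun_compose L)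
    ultimately show "L = (1/2) *\<^sub>R (T + (L o\<^sub>L L))" by (rule LIMSEQ_unique)
    fix P assume P: "closed P" "0 \<in> P" "\<And>Z. Z \<in> P \<Longrightarrow> (1/2) *\<^sub>R (T + (Z o\<^sub>L Z)) \<in> P"
    have "Y n \<in> P" for n by (induction n) (use P in \<open>auto simp: Y0 YS\<close>)
    then show "L \<in> P" using L closed_sequentially[OF P(1)] by blast
  qed
qed

section \<open>Symmetric and positive operators, their positive parts and resolvents\<close>

definition symm_op :: "('a::real_inner \<Rightarrow>\<^sub>L 'a) \<Rightarrow> bool" where
  "symm_op T \<longleftrightarrow> (\<forall>x y. inner (T x) y = inner x (T y))"

definition pos_op :: "('a::real_inner \<Rightarrow>\<^sub>L 'a) \<Rightarrow> bool" where
  "pos_op T \<longleftrightarrow> symm_op T \<and> (\<forall>x. 0 \<le> inner (T x) x)"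

lemma symm_op_intros:
  "symm_op id_blinfun" "symm_op S \<Longrightarrow> symm_op T \<Longrightarrow> symm_op (S + T)"
  "symm_op S \<Longrightarrow> symm_op T \<Longrightarrow> symm_op (S - T)"
  "symm_op T \<Longrightarrow> symm_op (r *\<^sub>R T)"
  "symm_op S \<Longrightarrow> symm_op T \<Longrightarrow> S o\<^sub>L T = T o\<^sub>L S \<Longrightarrow> symm_op (S o\<^sub>L T)"
  "symm_op (0 :: 'a::real_inner \<Rightarrow>\<^sub>L 'a)"
proof -
  show "symm_op (S o\<^sub>L T)" if "symm_op S" "symm_op T" "S o\<^sub>L T = T o\<^sub>L S"
    unfolding symm_op_def
  proof (intro allI)
    fix x y
    have "inner ((S o\<^sub>L T) x) y = inner x ((T o\<^sub>L S) y)"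
      using that(1,2) by (simp add: symm_op_def)
    then show "inner ((S o\<^sub>L T) x) y = inner x ((S o\<^sub>L T) y)" using that(3) by simp
  qed
qed (auto simp: symm_op_def blinfun_simps inner_simps)

lemma blinfun_eq_iff: "S = T \<longleftrightarrow> (\<forall>x. blinfun_apply S x = blinfun_apply T x)"
  by (auto intro: blinfun_eqI)

lemma closed_symm_op: "closed {T :: 'a::real_inner \<Rightarrow>\<^sub>L 'a. symm_op T}"
  unfolding symm_op_def
  by (intro closed_Collect_all closed_Collect_eq continuous_intros)

lemma closed_commutant: "closed {Z :: 'a::real_normed_vector \<Rightarrow>\<^sub>L 'a. Z o\<^sub>L C = C o\<^sub>L Z}"
proof -
  have "closed {Z :: 'a \<Rightarrow>\<^sub>L 'a. \<forall>x. Z (C x) = C (Z x)}"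
    by (intro closed_Collect_all closed_Collect_eq continuous_intros)
  then show ?thesis by (simp add: blinfun_eq_iff)
qed

lemma quadratic_nonneg_discriminant:
  fixes a b c :: real
  assumes "\<And>t. 0 \<le> a + 2 * t * b + t * t * c" "0 \<le> c"
  shows "b * b \<le> a * c"
proof (cases "c = 0")
  case True
  have "b = 0"
  proof (rule ccontr)
    assume "b \<noteq> 0"
    \<comment> \<open>At this \<open>t\<close> the remaining linear function takes the value
      -1.\<close>
    then show False using assms(1)[of "- (a + 1) / (2 * b)"] True by (simp add: field_simps)
  qed
  then show ?thesis using True by simp
next
  case False
  then show ?thesis using assms(1)[of "- b / c"] assms(2)
    by (simp add: field_simps)
qed

lemma pos_op_Cauchy_Schwarz:
  assumes "pos_op T"
  shows "(inner (T x) y)\<^sup>2 \<le> inner (T x) x * inner (T y) y"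
  unfolding power2_eq_square
proof (rule quadratic_nonneg_discriminant)
  have s: "inner (T y) x = inner (T x) y"
    using assms by (simp add: pos_op_def symm_op_def inner_commute)
  fix t
  have "0 \<le> inner (T (x + t *\<^sub>R y)) (x + t *\<^sub>R y)" using assms by (simp add: pos_op_def)
  also have "\<dots> = inner (T x) x + 2 * t * inner (T x) y + t * t * inner (T y) y"
    by (simp add: blinfun_simps inner_simps s algebra_simps)
  finally show "0 \<le> inner (T x) x + 2 * t * inner (T x) y + t * t * inner (T y) y" .
qed (use assms in \<open>auto simp: pos_op_def\<close>)

text \<open>Cauchy-Schwarz for the form of \<open>T\<close> at \<open>x\<close> and
  \<open>T x\<close> bounds the fourth power of the norm of \<open>T x\<close> by
  \<open>\<parallel>x\<parallel>\<^sup>2 \<parallel>T x\<parallel>\<^sup>2\<close>. This converts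
  order bounds into the norm bound that the iteration asks for.\<close>

lemma pos_op_norm_le_1:
  assumes "pos_op T" "pos_op (id_blinfun - T)"
  shows "norm T \<le> 1"
proof (rule norm_blinfun_bound)
  fix x
  have le: "inner (T u) u \<le> inner u u" for u
    using assms(2) by (auto simp: pos_op_def blinfun_simps inner_simps)
  have p: "0 \<le> inner (T u) u" for u using assms(1) by (auto simp: pos_op_def)
  have "(inner (T x) (T x))\<^sup>2 \<le> inner (T x) x * inner (T (T x)) (T x)"
    by (rule pos_op_Cauchy_Schwarz[OF assms(1)])
  also have "\<dots> \<le> inner x x * inner (T x) (T x)"
    by (intro mult_mono le p) simp
  finally have "inner (T x) (T x) \<le> inner x x"
    by (cases "T x = 0") (auto simp: power2_eq_square)
  then show "norm (T x) \<le> 1 * norm x" by (simp add: norm_le)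
qed simp

lemma pos_op_scaleR: "pos_op T \<Longrightarrow> 0 \<le> r \<Longrightarrow> pos_op (r *\<^sub>R T)"
  by (auto simp: pos_op_def symm_op_intros blinfun_simps)

lemma pos_op_add: "pos_op S \<Longrightarrow> pos_op T \<Longrightarrow> pos_op (S + T)"
  by (auto simp: pos_op_def symm_op_intros blinfun_simps inner_simps)

lemma symm_op_square_pos: "symm_op T \<Longrightarrow> pos_op (T o\<^sub>L T)"
  unfolding pos_op_def
proof (intro conjI allI)
  assume T: "symm_op T"
  then show "symm_op (T o\<^sub>L T)" by (simp add: symm_op_intros)
  fix x
  show "0 \<le> inner ((T o\<^sub>L T) x) x" using T[unfolded symm_op_def, rule_format, of "T x" x] by simp
qed

lemma inner_blinfun_le:
  fixes T :: "'a::real_inner \<Rightarrow>\<^sub>L 'a"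
  shows "inner (T x) x \<le> norm T * inner x x"
proof -
  have "inner (T x) x \<le> norm (T x) * norm x" by (rule norm_cauchy_schwarz)
  also have "\<dots> \<le> norm T * norm x * norm x" by (intro mult_right_mono norm_blinfun) auto
  finally show ?thesis by (simp add: power2_norm_eq_inner[symmetric] power2_eq_square)
qed

lemma symm_op_le_norm: "symm_op T \<Longrightarrow> norm T \<le> r \<Longrightarrow> pos_op (r *\<^sub>R id_blinfun - T)"
proof -
  assume "symm_op T" "norm T \<le> r"
  have "inner (T x) x \<le> r * inner x x" for x
    using inner_blinfun_le[of T x] mult_right_mono[OF \<open>norm T \<le> r\<close>, of "inner x x"] by simp
  then show ?thesis using \<open>symm_op T\<close>
    by (auto simp: pos_op_def symm_op_intros blinfun_simps inner_simps)
qed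

text \<open>With a symmetric square root \<open>S\<close> of (a multiple of) \<open>B\<close> that commutes with \<open>C\<close>,
  the form of \<open>B C\<close> at \<open>h\<close> is that of \<open>C\<close> at \<open>S h\<close>.\<close>

lemma pos_op_compose:
  fixes B C :: "'a::{real_inner,banach} \<Rightarrow>\<^sub>L 'a"
  assumes B: "pos_op B" and C: "pos_op C" and BC: "B o\<^sub>L C = C o\<^sub>L B"
  shows "pos_op (B o\<^sub>L C)"
proof -
  \<comment> \<open>Adding 1 keeps \<open>r\<close> positive when \<open>B = 0\<close>. Then
    \<open>0 \<le> T \<le> 1\<close>, and \<open>S = 1 - Y\<close> has
    \<open>S\<^sup>2 = 1 - T = B / r\<close>.\<close>
  define r where "r = norm B + 1"
  have r: "r > 0" "norm B \<le> r" by (auto simp: r_def add_nonneg_pos)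
  define T where "T = id_blinfun - (1/r) *\<^sub>R B"
  have sB: "symm_op B" and sC: "symm_op C" using B C by (auto simp: pos_op_def)
  have "T = (1/r) *\<^sub>R (r *\<^sub>R id_blinfun - B)"
    using r by (simp add: T_def algebra_simps)
  then have T1: "pos_op T" using symm_op_le_norm[OF sB r(2)] pos_op_scaleR[of _ "1/r"] r by auto
  have "id_blinfun - T = (1/r) *\<^sub>R B" by (simp add: T_def)
  then have T2: "pos_op (id_blinfun - T)" using B pos_op_scaleR[of _ "1/r"] r by auto
  obtain Y where Y: "Y = (1/2) *\<^sub>R (T + (Y o\<^sub>L Y))"
    and ind: "\<And>P. closed P \<Longrightarrow> 0 \<in> P \<Longrightarrow> (\<And>Z. Z \<in> P \<Longrightarrow> (1/2) *\<^sub>R (T + (Z o\<^sub>L Z)) \<in> P) \<Longrightarrow> Y \<in> P"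
    using blinfun_sqrt_iteration[OF pos_op_norm_le_1[OF T1 T2]] by blast
  have "Y \<in> {Z. symm_op Z} \<inter> {Z. Z o\<^sub>L C = C o\<^sub>L Z}"
  proof (rule ind)
    show "closed ({Z. symm_op Z} \<inter> {Z. Z o\<^sub>L C = C o\<^sub>L Z})"
      by (intro closed_Int closed_symm_op closed_commutant)
    fix Z assume Z: "Z \<in> {Z. symm_op Z} \<inter> {Z. Z o\<^sub>L C = C o\<^sub>L Z}"
    have "B (C x) = C (B x)" for x using BC by (simp add: blinfun_eq_iff)
    moreover have "Z (C x) = C (Z x)" for x using Z by (simp add: blinfun_eq_iff)
    ultimately show "(1/2) *\<^sub>R (T + (Z o\<^sub>L Z)) \<in> {Z. symm_op Z} \<inter> {Z. Z o\<^sub>L C = C o\<^sub>L Z}"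
      using Z T1 by (auto simp: symm_op_intros pos_op_def blinfun_eq_iff blinfun_simps T_def)
  qed (auto simp: symm_op_intros blinfun_eq_iff)
  then have Ys: "symm_op Y" and YC: "\<And>x. Y (C x) = C (Y x)" by (auto simp: blinfun_eq_iff)
  define S where "S = id_blinfun - Y"
  have Ss: "symm_op S" by (simp add: S_def Ys symm_op_intros)
  have SC: "S (C x) = C (S x)" for x by (simp add: S_def YC blinfun_simps)
  have SS: "B x = r *\<^sub>R S (S x)" for x
  proof -
    have "Y x = (1/2) *\<^sub>R (T x + Y (Y x))"
      using arg_cong[OF Y, of "\<lambda>Z. blinfun_apply Z x"] by (simp add: blinfun_simps)
    from arg_cong[OF this, of "\<lambda>u. 2 *\<^sub>R u"] have "2 *\<^sub>R Y x = T x + Y (Y x)" by simp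
    then have "(1/r) *\<^sub>R B x = S (S x)"
      by (simp add: S_def T_def blinfun_simps scaleR_2 algebra_simps)
    then have "r *\<^sub>R ((1/r) *\<^sub>R B x) = r *\<^sub>R S (S x)" by (rule arg_cong)
    then show ?thesis using r by simp
  qed
  have "0 \<le> inner ((B o\<^sub>L C) x) x" for x
  proof -
    have "inner ((B o\<^sub>L C) x) x = r * inner (C (S x)) (S x)"
    proof -
      have "(B o\<^sub>L C) x = r *\<^sub>R S (C (S x))" by (simp only: blinfun_apply_blinfun_compose SS SC)
      then show ?thesis using Ss by (simp add: symm_op_def)
    qed
    then show ?thesis using C r by (simp add: pos_op_def)
  qed
  then show ?thesis using symm_op_intros(5)[OF sB sC BC] by (simp add: pos_op_def)
qed

text \<open>Here \<open>Y\<close> plays the part of \<open>1 - |A|\<close>, the root coming from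
  \<open>T = 1 - A\<^sup>2\<close>, and \<open>R = (|A| + A) / 2\<close>. From
  \<open>|A|\<^sup>2 = A\<^sup>2\<close> and commutation follows \<open>R\<^sup>2 = A R\<close>.
  Positivity of \<open>R\<close> and of \<open>R - A = (|A| - A) / 2\<close> means that
  \<open>|A|\<close> dominates both \<open>- A\<close> and \<open>A\<close>.\<close>

lemma positive_part_contraction:
  fixes A :: "'a::{real_inner,banach} \<Rightarrow>\<^sub>L 'a"
  assumes A: "symm_op A" and n: "norm A \<le> 1"
  obtains R where "pos_op R" "pos_op (R - A)" "R o\<^sub>L R = A o\<^sub>L R"
    "\<And>C. oper_algebra C \<Longrightarrow> A \<in> C \<Longrightarrow> R \<in> C"
proof -
  define T where "T = id_blinfun - (A o\<^sub>L A)"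
  have nA2: "norm (A o\<^sub>L A) \<le> 1"
    using norm_blinfun_compose[of A A] mult_mono[OF n n] by simp
  have A2: "pos_op (A o\<^sub>L A)" by (rule symm_op_square_pos[OF A])
  have T1: "pos_op T"
    using symm_op_le_norm[OF _ nA2] A2 by (simp add: T_def pos_op_def)
  have T2: "pos_op (id_blinfun - T)" using A2 by (simp add: T_def)
  obtain Y where Y: "Y = (1/2) *\<^sub>R (T + (Y o\<^sub>L Y))"
    and ind: "\<And>P. closed P \<Longrightarrow> 0 \<in> P \<Longrightarrow> (\<And>Z. Z \<in> P \<Longrightarrow> (1/2) *\<^sub>R (T + (Z o\<^sub>L Z)) \<in> P) \<Longrightarrow> Y \<in> P"
    using blinfun_sqrt_iteration[OF pos_op_norm_le_1[OF T1 T2]] by blast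
  \<comment> \<open>Used for \<open>B = A\<close> and \<open>B = - A\<close>: as both have the
    square \<open>A\<^sup>2\<close>, the same \<open>Y\<close> lies below \<open>1 - A\<close> and
    \<open>1 + A\<close>. The bound is carried through the iteration together with positivity and
    commutation.\<close>
  have below: "pos_op Y \<and> Y o\<^sub>L B = B o\<^sub>L Y \<and> pos_op (id_blinfun - B - Y)"
    if B: "symm_op B" "norm B \<le> 1" "B o\<^sub>L B = A o\<^sub>L A" for B
  proof -
    let ?P = "{Z. pos_op Z \<and> Z o\<^sub>L B = B o\<^sub>L Z \<and> pos_op (id_blinfun - B - Z)}"
    have 1: "pos_op (id_blinfun - B)" using symm_op_le_norm[OF B(1,2)] by simp
    have "Y \<in> ?P"
    proof (rule ind)
      have eq: "?P = {Z. symm_op Z} \<inter> {Z. \<forall>x. 0 \<le> inner (blinfun_apply Z x) x} \<inter> {Z. Z o\<^sub>L B = B o\<^sub>L Z} \<inter>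
          {Z. \<forall>x. 0 \<le> inner ((id_blinfun - B - Z) x) x}"
        using B(1) by (auto simp: pos_op_def intro!: symm_op_intros)
      show "closed ?P"
        unfolding eq by (intro closed_Int closed_symm_op closed_commutant closed_Collect_all
            closed_Collect_le continuous_intros)
      show "0 \<in> ?P" using 1 by (auto simp: pos_op_def symm_op_intros blinfun_eq_iff)
      fix Z assume Z: "Z \<in> ?P"
      have ZB: "Z (B x) = B (Z x)" for x using Z by (simp add: blinfun_eq_iff)
      have BB: "B (B x) = A (A x)" for x using B(3) by (simp add: blinfun_eq_iff)
      let ?Z = "(1/2) *\<^sub>R (T + (Z o\<^sub>L Z))"
      have "pos_op ?Z"
        using Z T1 by (intro pos_op_scaleR pos_op_add symm_op_square_pos) (auto simp: pos_op_def)
      moreover have "?Z o\<^sub>L B = B o\<^sub>L ?Z"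
        by (auto simp: blinfun_eq_iff blinfun_simps T_def ZB BB[symmetric])
      \<comment> \<open>Since \<open>T = 1 - B\<^sup>2\<close>, twice the left side is
        \<open>(1 - B)\<^sup>2 - Z\<^sup>2\<close>. It factors into commuting operators that are
        positive by the invariant.\<close>
      moreover have "id_blinfun - B - ?Z =
          (1/2) *\<^sub>R ((id_blinfun - B - Z) o\<^sub>L (id_blinfun - B + Z))"
      proof (rule blinfun_eqI)
        fix x
        have "u - (1/2) *\<^sub>R w = (1/2) *\<^sub>R (u + u - w)" for u w :: 'a
          by (simp add: scaleR_diff_right)
        then have "(id_blinfun - B - ?Z) x = (1/2) *\<^sub>R ((x - B x) + (x - B x) - (T x + Z (Z x)))"
          by (simp add: blinfun.diff_left blinfun.scaleR_left blinfun.add_left)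
        also have "(x - B x) + (x - B x) - (T x + Z (Z x)) =
            ((id_blinfun - B - Z) o\<^sub>L (id_blinfun - B + Z)) x"
          by (simp add: blinfun_simps T_def ZB BB algebra_simps)
        finally show "(id_blinfun - B - ?Z) x =
          ((1/2) *\<^sub>R ((id_blinfun - B - Z) o\<^sub>L (id_blinfun - B + Z))) x"
          by (simp add: blinfun.scaleR_left)
      qed
      moreover have "pos_op \<dots>"
        using Z 1 by (intro pos_op_scaleR pos_op_compose pos_op_add)
          (auto simp: blinfun_eq_iff blinfun_simps ZB algebra_simps)
      ultimately show "?Z \<in> ?P" by simp
    qed
    then show ?thesis by simp
  qed
  have p1: "pos_op (id_blinfun - A - Y)" and YA: "\<And>x. Y (A x) = A (Y x)"
    using below[OF A n] by (auto simp: blinfun_eq_iff)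
  have p2: "pos_op (id_blinfun - (-A) - Y)"
  proof -
    have "symm_op (-A)" using symm_op_intros(4)[OF A, of "-1"] by simp
    moreover have "(-A) o\<^sub>L (-A) = A o\<^sub>L A" by (simp add: blinfun_eq_iff blinfun_simps)
    ultimately show ?thesis using below[of "-A"] n by simp
  qed
  have YY: "Y x + Y x = x - A (A x) + Y (Y x)" for x
  proof -
    have "Y x = (1/2) *\<^sub>R (T x + Y (Y x))"
      using arg_cong[OF Y, of "\<lambda>Z. blinfun_apply Z x"] by (simp add: blinfun_simps)
    from arg_cong[OF this, of "\<lambda>u. 2 *\<^sub>R u"] show ?thesis
      by (simp add: T_def blinfun_simps scaleR_2)
  qed
  define R where "R = (1/2) *\<^sub>R (id_blinfun - (-A) - Y)"
  show thesis
  proof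
    show "pos_op R" unfolding R_def by (intro pos_op_scaleR p2) simp
    have "R - A = (1/2) *\<^sub>R (id_blinfun - A - Y)"
    proof -
      have "(1/2) *\<^sub>R S - A = (1/2) *\<^sub>R (S - (A + A))" for S
        by (simp add: scaleR_diff_right)
      then show ?thesis unfolding R_def by (simp add: algebra_simps)
    qed
    then show "pos_op (R - A)" using pos_op_scaleR[OF p1, of "1/2"] by simp
    show "R o\<^sub>L R = A o\<^sub>L R"
    proof (rule blinfun_eqI)
      fix x
      have "Y (Y x) = Y x + Y x - x + A (A x)" using YY[of x] by (simp add: algebra_simps)
      then have "(id_blinfun - (-A) - Y) ((id_blinfun - (-A) - Y) x) =
          2 *\<^sub>R A ((id_blinfun - (-A) - Y) x)"
        by (simp add: blinfun_simps YA scaleR_2 algebra_simps)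
      then show "(R o\<^sub>L R) x = (A o\<^sub>L R) x"
        by (simp add: R_def blinfun.scaleR_left blinfun.scaleR_right)
    qed
    fix C assume C: "oper_algebra C" "A \<in> C"
    note Cs = oper_algebraD[OF C(1)]
    have "0 \<in> C" using Cs(5)[OF C(2), of 0] by simp
    have "T \<in> C" unfolding T_def by (intro Cs C)
    then have "Y \<in> C" by (intro ind Cs \<open>0 \<in> C\<close>)
    moreover have "- A \<in> C" using Cs(5)[OF C(2), of "-1"] by simp
    ultimately show "R \<in> C" unfolding R_def by (intro Cs)
  qed
qed

lemma positive_part:
  fixes A :: "'a::{real_inner,banach} \<Rightarrow>\<^sub>L 'a"
  assumes A: "symm_op A"
  obtains R where "pos_op R" "pos_op (R - A)" "R o\<^sub>L R = A o\<^sub>L R"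
    "\<And>C. oper_algebra C \<Longrightarrow> A \<in> C \<Longrightarrow> R \<in> C"
proof -
  define r where "r = norm A + 1"
  have r: "r > 0" by (auto simp: r_def add_nonneg_pos)
  have rA: "A = r *\<^sub>R ((1/r) *\<^sub>R A)" using r by simp
  have n: "norm ((1/r) *\<^sub>R A) \<le> 1" using r by (simp add: r_def)
  obtain R where R: "pos_op R" "pos_op (R - (1/r) *\<^sub>R A)" "R o\<^sub>L R = ((1/r) *\<^sub>R A) o\<^sub>L R"
    "\<And>C. oper_algebra C \<Longrightarrow> (1/r) *\<^sub>R A \<in> C \<Longrightarrow> R \<in> C"
    using positive_part_contraction[OF symm_op_intros(4)[OF A] n] by blast
  show thesis
  proof
    show "pos_op (r *\<^sub>R R)" using R(1) r by (intro pos_op_scaleR) auto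
    have "r *\<^sub>R R - A = r *\<^sub>R (R - (1/r) *\<^sub>R A)" using r by (simp add: scaleR_diff_right)
    then show "pos_op (r *\<^sub>R R - A)" using pos_op_scaleR[OF R(2), of r] r by auto
    show "(r *\<^sub>R R) o\<^sub>L (r *\<^sub>R R) = A o\<^sub>L (r *\<^sub>R R)"
      using R(3) r by (simp add: blinfun_eq_iff blinfun_simps)
    show "r *\<^sub>R R \<in> C" if "oper_algebra C" "A \<in> C" for C
      using R(4)[OF that(1)] that oper_algebraD(5) by blast
  qed
qed

text \<open>\<open>R\<close> may be large, so the Neumann series is not taken in \<open>R\<close>.
  As \<open>0 \<le> R \<le> r\<close>, one has \<open>1 + R = (1 + r) (1 - V)\<close> with
  \<open>V = (r - R) / (1 + r)\<close> of norm at most \<open>q = r / (1 + r) < 1\<close>. The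
  inverse of \<open>1 - V\<close> is the fixed point of \<open>Z \<mapsto> 1 + V Z\<close>, and it
  lies in every nonempty closed set that this map preserves.\<close>

lemma neumann_inverse:
  fixes R :: "'a::{real_inner,banach} \<Rightarrow>\<^sub>L 'a"
  assumes R: "pos_op R"
  obtains G :: "'a \<Rightarrow>\<^sub>L 'a" where "\<And>x. G x + R (G x) = x" "\<And>x. G x + G (R x) = x"
    "\<And>C. oper_algebra C \<Longrightarrow> R \<in> C \<Longrightarrow> G \<in> C"
proof -
  define r where "r = norm R + 1"
  have r: "r > 0" "norm R \<le> r" by (auto simp: r_def add_nonneg_pos)
  define W where "W = (1/r) *\<^sub>R (r *\<^sub>R id_blinfun - R)"
  have 1: "pos_op W" unfolding W_def using R r
    by (intro pos_op_scaleR symm_op_le_norm) (auto simp: pos_op_def)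
  have "id_blinfun - W = (1/r) *\<^sub>R R"
    using r by (simp add: W_def scaleR_diff_right)
  then have 2: "pos_op (id_blinfun - W)" using R r pos_op_scaleR[of R "1/r"] by auto
  define q where "q = r / (1 + r)"
  have q: "0 \<le> q" "q < 1" using r by (auto simp: q_def)
  define V where "V = q *\<^sub>R W"
  have nV: "norm V \<le> q" using pos_op_norm_le_1[OF 1 2] q by (simp add: V_def mult_left_le)
  have V: "(1 + r) *\<^sub>R (x - V x) = x + R x" for x
  proof -
    have "(1 + r) * q = r" using r by (simp add: q_def)
    then have "(1 + r) *\<^sub>R V x = r *\<^sub>R W x" by (simp add: V_def blinfun.scaleR_left)
    also have "\<dots> = r *\<^sub>R x - R x" using r by (simp add: W_def blinfun_simps)
    finally show ?thesis by (simp add: scaleR_diff_right algebra_simps)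
  qed
  have fix1: "\<exists>!Z\<in>C. id_blinfun + (V o\<^sub>L Z) = Z"
    if C: "closed C" "C \<noteq> {}" "\<And>Z. Z \<in> C \<Longrightarrow> id_blinfun + (V o\<^sub>L Z) \<in> C" for C
  proof (rule Banach_fix[OF _ C(2) q])
    show "complete C" using C(1) complete_eq_closed by blast
    show "(\<lambda>Z. id_blinfun + (V o\<^sub>L Z)) ` C \<subseteq> C" using C(3) by blast
    fix Y Z
    have "dist (id_blinfun + (V o\<^sub>L Y)) (id_blinfun + (V o\<^sub>L Z)) = norm (V o\<^sub>L (Y - Z))"
      by (simp add: dist_norm) (rule arg_cong[of _ _ norm], simp add: blinfun_eq_iff blinfun_simps)
    also have "\<dots> \<le> q * norm (Y - Z)"
      by (rule order_trans[OF norm_blinfun_compose]) (intro mult_right_mono nV, simp)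
    finally show "dist (id_blinfun + (V o\<^sub>L Y)) (id_blinfun + (V o\<^sub>L Z)) \<le> q * dist Y Z"
      by (simp add: dist_norm)
  qed
  obtain Z where Z: "id_blinfun + (V o\<^sub>L Z) = Z"
    and uni: "\<And>Z'. id_blinfun + (V o\<^sub>L Z') = Z' \<Longrightarrow> Z' = Z"
    using fix1[of UNIV] by auto
  have mem: "Z \<in> C" if "closed C" "C \<noteq> {}" "\<And>Z. Z \<in> C \<Longrightarrow> id_blinfun + (V o\<^sub>L Z) \<in> C" for C
    using fix1[OF that] uni by blast
  \<comment> \<open>The fixed point equation makes \<open>Z\<close> a right inverse; commutation
    makes it a left inverse as well, which later gives
    \<open>x\<^sub>j G = x\<^sub>j - x\<^sub>j G R\<close>.\<close>
  have ZV: "Z o\<^sub>L V = V o\<^sub>L Z"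
  proof -
    have "Z \<in> {Z. Z o\<^sub>L V = V o\<^sub>L Z}"
    proof (rule mem[OF closed_commutant])
      show "{Z. Z o\<^sub>L V = V o\<^sub>L Z} \<noteq> {}" by blast
    qed (auto simp: blinfun_eq_iff blinfun_simps)
    then show ?thesis by simp
  qed
  define G where "G = (1 / (1 + r)) *\<^sub>R Z"
  have Gr: "(1 + r) *\<^sub>R G x = Z x" for x using r by (simp add: G_def blinfun_simps)
  have Zx: "Z x - V (Z x) = x" for x
    using arg_cong[OF Z, of "\<lambda>Z. blinfun_apply Z x"] by (simp add: blinfun_simps algebra_simps)
  have Zx': "Z x - Z (V x) = x" for x
    using Zx[of x] ZV by (simp add: blinfun_eq_iff)
  show thesis
  proof
    show "G x + R (G x) = x" for x
      using Zx[of x] by (simp add: V[symmetric] Gr[symmetric] blinfun_simps scaleR_diff_right)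
    have "G x + G (R x) = Z (x - V x)" for x
      by (simp add: blinfun.add_right[symmetric] V[symmetric] blinfun.scaleR_right[symmetric] Gr[symmetric])
    then show "G x + G (R x) = x" for x using Zx'[of x] by (simp add: blinfun_simps)
    fix C assume C: "oper_algebra C" "R \<in> C"
    note Cs = oper_algebraD[OF C(1)]
    have "V \<in> C" unfolding V_def W_def by (intro Cs C)
    then have "Z \<in> C" by (intro mem Cs) (use Cs(2) in auto)
    then show "G \<in> C" unfolding G_def by (rule Cs)
  qed
qed

text \<open>As \<open>A \<le> R\<close>, the resolvent \<open>G = (1 + R)\<inverse>\<close> satisfies
  \<open>G (1 + A) G \<le> G (1 + R)\<^sup>2 G = 1\<close>.\<close>

lemma inverse_positive_part_bound:
  assumes R: "pos_op R" "pos_op (R - A)" and G: "\<And>x. G x + R (G x) = x"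
  shows "inner (G h + A (G h)) (G h) \<le> inner h h"
proof -
  let ?u = "G h"
  have "0 \<le> inner (R ?u) ?u" using R(1) by (simp add: pos_op_def)
  moreover have "inner (A ?u) ?u \<le> inner (R ?u) ?u"
    using R(2) by (simp add: pos_op_def blinfun_simps inner_simps)
  moreover have "0 \<le> inner (R ?u) (R ?u)" by simp
  moreover have "inner h h = inner (?u + R ?u) (?u + R ?u)" by (simp add: G)
  ultimately show ?thesis by (simp add: inner_simps inner_commute[of "R ?u" ?u] inner_commute[of "A ?u" ?u], linarith)
qed

section \<open>The Hilbert space of square-summable sequences\<close>

lemma summable_seq_of: "summable (\<lambda>n. (cmod (seq_of x n))\<^sup>2)"
  using seq_of[of x] by simp

lemma ell2_eqI: "(\<And>n. seq_of x n = seq_of y n) \<Longrightarrow> x = y"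
  by (metis ext seq_of_inject)

lemma cinner_add_left: "cinner (x + y) z = cinner x z + cinner y z"
  unfolding cinner.rep_eq
  by (subst suminf_add[OF summable_mult_cnj summable_mult_cnj])
    (auto simp: summable_seq_of plus_ell2.rep_eq algebra_simps)

lemma cinner_scaleC_left: "cinner (c *\<^sub>C x) y = c * cinner x y"
  unfolding cinner.rep_eq
  by (subst suminf_mult[OF summable_mult_cnj, symmetric])
    (auto simp: summable_seq_of scaleC.rep_eq algebra_simps)

lemma cinner_commute: "cinner y x = cnj (cinner x y)"
proof -
  have "(\<lambda>n. seq_of x n * cnj (seq_of y n)) sums cinner x y"
    unfolding cinner.rep_eq by (intro summable_sums summable_mult_cnj summable_seq_of)
  then have "(\<lambda>n. cnj (seq_of x n * cnj (seq_of y n))) sums cnj (cinner x y)"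
    by (simp only: sums_cnj)
  then have "(\<lambda>n. seq_of y n * cnj (seq_of x n)) sums cnj (cinner x y)"
    by (simp add: mult.commute)
  then show ?thesis unfolding cinner.rep_eq[of y x] by (rule sums_unique[symmetric])
qed

lemma cinner_add_right: "cinner x (y + z) = cinner x y + cinner x z"
  by (subst (1 2 3) cinner_commute) (simp add: cinner_add_left)

lemma cinner_scaleC_right: "cinner x (c *\<^sub>C y) = cnj c * cinner x y"
  by (subst (1 2) cinner_commute) (simp add: cinner_scaleC_left)

lemma scaleR_ell2_scaleC: "r *\<^sub>R x = complex_of_real r *\<^sub>C (x :: ell2)"
  by (rule ell2_eqI) (simp add: scaleR_ell2.rep_eq scaleC.rep_eq)

lemma cinner_self: "cinner x x = complex_of_real ((norm x)\<^sup>2)"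
proof -
  have "Im (cinner x x) = 0" using arg_cong[OF cinner_commute[of x x], of Im] by simp
  moreover have "Re (cinner x x) = (norm x)\<^sup>2"
    by (simp add: power2_norm_eq_inner inner_ell2_def)
  ultimately show ?thesis by (simp add: complex_eq_iff)
qed

lemma scaleC_simps:
  "c *\<^sub>C (x + y) = c *\<^sub>C x + c *\<^sub>C y" "c *\<^sub>C (x - y) = c *\<^sub>C x - c *\<^sub>C y"
  "(c + d) *\<^sub>C x = c *\<^sub>C x + d *\<^sub>C x" "c *\<^sub>C d *\<^sub>C x = (c * d) *\<^sub>C x"
  "1 *\<^sub>C x = x" "0 *\<^sub>C x = 0" "c *\<^sub>C 0 = 0" "(-1) *\<^sub>C x = - x"
  by (rule ell2_eqI; simp add: scaleC.rep_eq plus_ell2.rep_eq minus_ell2.rep_eq zero_ell2.rep_eq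
    uminus_ell2.rep_eq algebra_simps)+

lemma cinner_zero: "cinner 0 x = 0" "cinner x 0 = 0"
  using cinner_scaleC_left[of 0 x x] cinner_scaleC_right[of x 0 x] by (simp_all add: scaleC_simps)

lemma cinner_diff_left: "cinner (x - y) z = cinner x z - cinner y z"
  using cinner_add_left[of "x - y" y z] by simp

lemma cinner_diff_right: "cinner x (y - z) = cinner x y - cinner x z"
  using cinner_add_right[of x "y - z" z] by simp

lemma cinner_sum_left: "cinner (\<Sum>i\<in>I. f i) y = (\<Sum>i\<in>I. cinner (f i) y)"
  by (induction I rule: infinite_finite_induct) (auto simp: cinner_zero cinner_add_left)

lemma cinner_sum_right: "cinner y (\<Sum>i\<in>I. f i) = (\<Sum>i\<in>I. cinner y (f i))"
  by (induction I rule: infinite_finite_induct) (auto simp: cinner_zero cinner_add_right)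

lemmas cinner_simps = cinner_add_left cinner_add_right cinner_diff_left cinner_diff_right
  cinner_scaleC_left cinner_scaleC_right cinner_sum_left cinner_sum_right cinner_zero

lemma cmod_cinner_le: "cmod (cinner x y) \<le> norm x * norm y"
proof (cases "cinner x y = 0")
  case False
  \<comment> \<open>The phase \<open>u\<close> turns the inner product into its modulus, so that the
    real Cauchy-Schwarz inequality applies.\<close>
  define u where "u = cnj (cinner x y) / cmod (cinner x y)"
  have u: "cmod u = 1" using False by (simp add: u_def norm_divide)
  have "cinner (u *\<^sub>C x) y = cmod (cinner x y)"
  proof -
    have "cinner (u *\<^sub>C x) y = cnj (cinner x y) * cinner x y / cmod (cinner x y)"
      by (simp add: cinner_scaleC_left u_def)
    also have "cnj (cinner x y) * cinner x y = complex_of_real ((cmod (cinner x y))\<^sup>2)"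
      using complex_norm_square[of "cinner x y"] by (simp add: mult.commute)
    finally show ?thesis using False by (simp add: power2_eq_square)
  qed
  then have "cmod (cinner x y) = inner (u *\<^sub>C x) y" by (simp add: inner_ell2_def)
  also have "\<dots> \<le> norm (u *\<^sub>C x) * norm y" by (rule norm_cauchy_schwarz)
  also have "\<dots> = norm x * norm y" by (simp add: norm_scaleC u)
  finally show ?thesis .
qed simp

lemma bounded_bilinear_cinner: "bounded_bilinear cinner"
  by standard (auto simp: cinner_simps scaleR_ell2_scaleC scaleR_conv_of_real intro!: exI[of _ 1] cmod_cinner_le)

lemmas tendsto_cinner = bounded_bilinear.tendsto[OF bounded_bilinear_cinner]

lemma cinner_eqI: "(\<And>y. cinner x y = cinner x' y) \<Longrightarrow> x = x'"
  using cinner_self[of "x - x'"] by (simp add: cinner_diff_left)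

lift_definition ket :: "nat \<Rightarrow> ell2" is "\<lambda>n m. if m = n then 1 else 0"
  subgoal for n
    by (rule summable_finite[of "{n}"]) auto
  done

lemma cinner_ket_right: "cinner x (ket n) = seq_of x n"
proof -
  have "(\<lambda>m. seq_of x m * cnj (seq_of (ket n) m)) = (\<lambda>m. if m = n then seq_of x m else 0)"
    by (auto simp: ket.rep_eq)
  then show ?thesis
    unfolding cinner.rep_eq using sums_unique[OF sums_single[of n "seq_of x"]] by simp
qed

lemma cmod_seq_of_le: "cmod (seq_of x n) \<le> norm x"
proof -
  have "(cmod (seq_of x n))\<^sup>2 \<le> (\<Sum>n. (cmod (seq_of x n))\<^sup>2)"
    using sum_le_suminf[OF summable_seq_of[of x], of "{n}"] by simp
  then show ?thesis by (simp add: norm_ell2.rep_eq real_le_rsqrt)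
qed

text \<open>Bounds on partial sums are what can be checked for a vector known by its coordinates
  only. Limits of Cauchy sequences, values of adjoints and weak limits are all obtained this
  way.\<close>

lemma ell2_from_bounded_sums:
  assumes "\<And>N. (\<Sum>n<N. (cmod (f n))\<^sup>2) \<le> B\<^sup>2" "0 \<le> B"
  obtains x where "seq_of x = f" "norm x \<le> B"
proof -
  have s: "summable (\<lambda>n. (cmod (f n))\<^sup>2)"
    by (rule summableI_nonneg_bounded[of _ "B\<^sup>2"]) (use assms in auto)
  have x: "seq_of (Abs_ell2 f) = f" by (rule Abs_ell2_inverse) (simp add: s)
  have "(\<Sum>n. (cmod (f n))\<^sup>2) \<le> B\<^sup>2" by (rule suminf_le_const[OF s assms(1)])
  then have "norm (Abs_ell2 f) \<le> B" using assms(2) by (simp add: norm_ell2.rep_eq x real_le_lsqrt suminf_nonneg s)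
  then show ?thesis using that x by blast
qed

lemma ell2_partial_sum_le: "(\<Sum>n<N. (cmod (seq_of x n))\<^sup>2) \<le> (norm x)\<^sup>2"
  using sum_le_suminf[OF summable_seq_of[of x], of "{..<N}"]
  by (simp add: norm_ell2.rep_eq suminf_nonneg summable_seq_of)

lemma seq_of_minus: "seq_of (x - y) n = seq_of x n - seq_of y n"
  by (simp add: minus_ell2.rep_eq)

instance ell2 :: banach
proof
  fix X :: "nat \<Rightarrow> ell2" assume X: "Cauchy X"
  have "Cauchy (\<lambda>m. seq_of (X m) n)" for n
  proof (rule metric_CauchyI)
    fix e :: real assume "0 < e"
    then obtain M where M: "\<And>m k. m \<ge> M \<Longrightarrow> k \<ge> M \<Longrightarrow> dist (X m) (X k) < e"
      using metric_CauchyD[OF X] by blast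
    have "dist (seq_of (X m) n) (seq_of (X k) n) \<le> dist (X m) (X k)" for m k
      using cmod_seq_of_le[of "X m - X k" n] by (simp add: dist_norm seq_of_minus)
    then show "\<exists>M. \<forall>m\<ge>M. \<forall>k\<ge>M. dist (seq_of (X m) n) (seq_of (X k) n) < e"
      using M le_less_trans by blast
  qed
  then obtain f where f: "\<And>n. (\<lambda>m. seq_of (X m) n) \<longlonglongrightarrow> f n"
    unfolding Cauchy_convergent_iff convergent_def by metis
  \<comment> \<open>It is not yet known that \<open>f\<close> is square-summable, so its difference
    from \<open>X m\<close> is placed in the space first, and \<open>f\<close> is recovered from it
    as \<open>X M - d\<close>.\<close>
  have tail: "\<exists>x. seq_of x = (\<lambda>n. seq_of (X m) n - f n) \<and> norm x \<le> e"
    if e: "0 < e" and M: "\<And>m k. m \<ge> M \<Longrightarrow> k \<ge> M \<Longrightarrow> dist (X m) (X k) < e" and m: "m \<ge> M" for e M m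
  proof -
    have "(\<Sum>n<N. (cmod (seq_of (X m) n - f n))\<^sup>2) \<le> e\<^sup>2" for N
    proof (rule tendsto_upperbound)
      show "(\<lambda>k. \<Sum>n<N. (cmod (seq_of (X m) n - seq_of (X k) n))\<^sup>2) \<longlonglongrightarrow>
          (\<Sum>n<N. (cmod (seq_of (X m) n - f n))\<^sup>2)"
        by (intro tendsto_intros f)
      show "\<forall>\<^sub>F k in sequentially. (\<Sum>n<N. (cmod (seq_of (X m) n - seq_of (X k) n))\<^sup>2) \<le> e\<^sup>2"
        using eventually_ge_at_top[of M]
      proof eventually_elim
        case (elim k)
        have "(norm (X m - X k))\<^sup>2 \<le> e\<^sup>2"
          using M[OF m elim] by (intro power_mono) (auto simp: dist_norm)
        then show ?case using ell2_partial_sum_le[where N=N and x="X m - X k"] by (simp add: seq_of_minus)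
      qed
    qed auto
    then show ?thesis using ell2_from_bounded_sums[of _ e] e by (metis less_imp_le)
  qed
  obtain M where "\<And>m k. m \<ge> M \<Longrightarrow> k \<ge> M \<Longrightarrow> dist (X m) (X k) < 1"
    using metric_CauchyD[OF X, of 1] by auto
  then obtain d where d: "seq_of d = (\<lambda>n. seq_of (X M) n - f n)"
    using tail[of 1 M M] by auto
  define L where "L = X M - d"
  have L: "seq_of L n = f n" for n by (simp add: L_def seq_of_minus d)
  have "X \<longlonglongrightarrow> L"
  proof (rule metric_LIMSEQ_I)
    fix e :: real assume "0 < e"
    then obtain M where M: "\<And>m k. m \<ge> M \<Longrightarrow> k \<ge> M \<Longrightarrow> dist (X m) (X k) < e/2"
      using metric_CauchyD[OF X half_gt_zero] by blast
    have "dist (X m) L < e" if m: "m \<ge> M" for m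
    proof -
      obtain x where x: "seq_of x = (\<lambda>n. seq_of (X m) n - f n)" "norm x \<le> e/2"
        using tail[OF _ M m] \<open>0 < e\<close> by auto
      have "x = X m - L" by (rule ell2_eqI) (simp add: x seq_of_minus L)
      then show ?thesis using x \<open>0 < e\<close> by (simp add: dist_norm)
    qed
    then show "\<exists>M. \<forall>m\<ge>M. dist (X m) L < e" by blast
  qed
  then show "convergent X" by (rule convergentI)
qed

definition fvec :: "nat \<Rightarrow> (nat \<Rightarrow> complex) \<Rightarrow> ell2" where
  "fvec N f = (\<Sum>n<N. f n *\<^sub>C ket n)"

lemma seq_of_sum: "seq_of (\<Sum>i\<in>I. f i) n = (\<Sum>i\<in>I. seq_of (f i) n)"
  by (induction I rule: infinite_finite_induct) (auto simp: zero_ell2.rep_eq plus_ell2.rep_eq)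

lemma seq_of_fvec: "seq_of (fvec N f) n = (if n < N then f n else 0)"
  by (simp add: fvec_def seq_of_sum scaleC.rep_eq ket.rep_eq if_distrib[of "\<lambda>z. _ * z"]
    cong: if_cong)

lemma norm_fvec: "(norm (fvec N f))\<^sup>2 = (\<Sum>n<N. (cmod (f n))\<^sup>2)"
proof -
  have "(\<Sum>n. (cmod (seq_of (fvec N f) n))\<^sup>2) = (\<Sum>n<N. (cmod (seq_of (fvec N f) n))\<^sup>2)"
    by (rule suminf_finite) (auto simp: seq_of_fvec)
  then show ?thesis by (simp add: norm_ell2.rep_eq seq_of_fvec sum_nonneg)
qed

lemma fvec_tendsto: "(\<lambda>N. fvec N (seq_of x)) \<longlonglongrightarrow> x"
proof -
  let ?s = "\<lambda>N. \<Sum>n<N. (cmod (seq_of x n))\<^sup>2"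
  have "(norm (x - fvec N (seq_of x)))\<^sup>2 = (norm x)\<^sup>2 - ?s N" for N
  proof -
    have "inner x (fvec N (seq_of x)) = ?s N"
      by (simp add: inner_ell2_def fvec_def cinner_simps cinner_ket_right cmod_power2
        power2_eq_square[of "Re _"] power2_eq_square[of "Im _"])
    then show ?thesis using norm_fvec[of N "seq_of x"]
      by (simp add: power2_norm_eq_inner inner_diff_left inner_diff_right inner_commute)
  qed
  moreover have "?s \<longlonglongrightarrow> (norm x)\<^sup>2"
    using summable_LIMSEQ[OF summable_seq_of[of x]]
    by (simp add: norm_ell2.rep_eq suminf_nonneg summable_seq_of)
  ultimately have "(\<lambda>N. (norm (x - fvec N (seq_of x)))\<^sup>2) \<longlonglongrightarrow> (norm x)\<^sup>2 - (norm x)\<^sup>2"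
    by (simp only:) (intro tendsto_intros)
  then have "(\<lambda>N. norm (x - fvec N (seq_of x))) \<longlonglongrightarrow> 0"
    using tendsto_real_sqrt[of "\<lambda>N. (norm (x - fvec N (seq_of x)))\<^sup>2" 0 sequentially] by simp
  then have "(\<lambda>N. x - (x - fvec N (seq_of x))) \<longlonglongrightarrow> x - 0"
    by (rule tendsto_diff[OF tendsto_const tendsto_norm_zero_cancel])
  then show ?thesis by simp
qed

section \<open>Adjoints and generated C*-algebras\<close>

lemma bounded_opsD: "T \<in> \<bbbB> \<Longrightarrow> T (c *\<^sub>C x) = c *\<^sub>C T x"
  by (simp add: bounded_ops_def)

text \<open>Riesz representation by coordinates: the value at \<open>x\<close> must have the
  coordinates \<open>f n\<close>. Testing on the truncation \<open>v\<close> of \<open>f\<close>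
  itself gives \<open>\<parallel>v\<parallel>\<^sup>2 = \<langle>x, T v\<rangle> \<le>
  \<parallel>x\<parallel> \<parallel>T\<parallel> \<parallel>v\<parallel>\<close>, which bounds the
  partial sums.\<close>

lemma adjoint_exists:
  assumes T: "T \<in> \<bbbB>"
  obtains S where "S \<in> \<bbbB>" "\<And>x y. cinner (blinfun_apply S x) y = cinner x (blinfun_apply T y)"
proof -
  have "\<exists>s. norm s \<le> norm T * norm x \<and> (\<forall>y. cinner s y = cinner x (T y))" for x
  proof -
    define f where "f n = cinner x (T (ket n))" for n
    have fv: "cinner x (T (fvec N g)) = (\<Sum>n<N. cnj (g n) * f n)" for N g
      by (simp add: fvec_def blinfun.sum_right bounded_opsD[OF T] cinner_simps f_def)
    have "(\<Sum>n<N. (cmod (f n))\<^sup>2) \<le> (norm T * norm x)\<^sup>2" for N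
    proof -
      let ?v = "fvec N f"
      have "complex_of_real ((norm ?v)\<^sup>2) = cinner x (T ?v)"
        by (simp add: fv norm_fvec complex_norm_square mult.commute flip: of_real_power)
      then have "(norm ?v)\<^sup>2 = cmod (cinner x (T ?v))"
        by (metis norm_of_real abs_power2)
      also have "\<dots> \<le> norm x * (norm T * norm ?v)"
        by (rule order_trans[OF cmod_cinner_le]) (intro mult_left_mono norm_blinfun, simp)
      finally have "norm ?v \<le> norm T * norm x"
        by (cases "norm ?v = 0") (auto simp: power2_eq_square mult_ac)
      then have "(norm ?v)\<^sup>2 \<le> (norm T * norm x)\<^sup>2" by (intro power_mono) auto
      then show ?thesis by (simp add: norm_fvec)
    qed
    then obtain s where s: "seq_of s = f" "norm s \<le> norm T * norm x"
      using ell2_from_bounded_sums[of f "norm T * norm x"] by auto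
    have "cinner s y = cinner x (T y)" for y
    proof (rule LIMSEQ_unique)
      show "(\<lambda>N. cinner s (fvec N (seq_of y))) \<longlonglongrightarrow> cinner s y"
        by (intro tendsto_cinner tendsto_const fvec_tendsto)
      have "cinner s (fvec N (seq_of y)) = cinner x (T (fvec N (seq_of y)))" for N
        by (simp add: fv) (simp add: fvec_def cinner_simps cinner_ket_right s)
      then show "(\<lambda>N. cinner s (fvec N (seq_of y))) \<longlonglongrightarrow> cinner x (T y)"
        by (simp only:) (intro tendsto_cinner tendsto_const blinfun.tendsto fvec_tendsto)
    qed
    then show ?thesis using s by blast
  qed
  then obtain S where S: "\<And>x. norm (S x) \<le> norm T * norm x" "\<And>x y. cinner (S x) y = cinner x (T y)"
    by metis
  have "bounded_linear S"
    by (rule bounded_linear_intro[where K = "norm T"])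
      (auto intro!: cinner_eqI simp: S(2) cinner_simps scaleR_ell2_scaleC, metis S(1) mult.commute)
  then have ap: "blinfun_apply (Blinfun S) = S" by (rule bounded_linear_Blinfun_apply)
  show thesis
  proof (rule that[of "Blinfun S"])
    show "Blinfun S \<in> \<bbbB>"
      by (auto simp: bounded_ops_def ap S cinner_simps intro!: cinner_eqI)
  qed (simp add: ap S)
qed

lemma adj_props:
  assumes "T \<in> \<bbbB>"
  shows "adj T \<in> \<bbbB>" "cinner (adj T x) y = cinner x (T y)" "cinner (T x) y = cinner x (adj T y)"
proof -
  obtain S where S: "S \<in> \<bbbB>" "\<And>x y. cinner (blinfun_apply S x) y = cinner x (blinfun_apply T y)"
    using adjoint_exists[OF assms] by blast
  have "adj T = S" unfolding adj_def
  proof (rule the_equality)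
    fix S' assume "\<forall>x y. cinner (blinfun_apply S' x) y = cinner x (blinfun_apply T y)"
    then show "S' = S" by (intro blinfun_eqI cinner_eqI) (simp add: S)
  qed (simp add: S)
  then show "adj T \<in> \<bbbB>" and *: "\<And>x y. cinner (adj T x) y = cinner x (T y)" using S by auto
  show "cinner (T x) y = cinner x (adj T y)"
    by (subst (1 2) cinner_commute) (simp add: *)
qed

lemma cstar_subalgebra_bounded_ops: "cstar_subalgebra \<bbbB>"
  unfolding cstar_subalgebra_def
proof (intro conjI ballI allI)
  show "closed \<bbbB>" unfolding bounded_ops_def
    by (intro closed_Collect_all closed_Collect_eq continuous_intros
        bounded_linear.continuous_on[OF bounded_linear_scaleC])
qed (auto simp: adj_props(1), auto simp: bounded_ops_def blinfun_simps scaleC_simps mult.commute)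

lemma cstar_subalgebra_cstar:
  assumes "S \<subseteq> \<bbbB>"
  shows "cstar_subalgebra (cstar S)"
proof -
  have "\<bbbB> \<in> {t. cstar_subalgebra t \<and> S \<subseteq> t}" using assms cstar_subalgebra_bounded_ops by simp
  then have sub: "cstar S \<subseteq> \<bbbB>" unfolding cstar_def hull_def by blast
  have cl: "closed (cstar S)"
    unfolding cstar_def hull_def by (rule closed_Inter) (auto simp: cstar_subalgebra_def)
  have "T \<in> cstar S \<longleftrightarrow> (\<forall>t. cstar_subalgebra t \<longrightarrow> S \<subseteq> t \<longrightarrow> T \<in> t)" for T
    unfolding cstar_def hull_def by blast
  with sub cl show ?thesis unfolding cstar_subalgebra_def by simp
qed

lemma cstar_subset: "S \<subseteq> cstar S"
  unfolding cstar_def by (rule hull_subset)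

lemma cstar_minimal: "S \<subseteq> A \<Longrightarrow> cstar_subalgebra A \<Longrightarrow> cstar S \<subseteq> A"
  unfolding cstar_def by (rule hull_minimal)

lemma cstar_subalgebra_oper_algebra:
  assumes "cstar_subalgebra A"
  shows "oper_algebra A"
proof -
  have "r *\<^sub>R T = complex_of_real r *\<^sub>O T" for r and T :: opr
    by (rule blinfun_eqI) (simp add: blinfun.scaleR_left scaleR_ell2_scaleC)
  then show ?thesis using assms by (auto simp: cstar_subalgebra_def oper_algebra_def)
qed

section \<open>Weakly null sequences and compact operators\<close>

definition weakly_null :: "(nat \<Rightarrow> ell2) \<Rightarrow> bool" where
  "weakly_null \<xi> \<longleftrightarrow> bounded (range \<xi>) \<and> (\<forall>v. (\<lambda>m. cinner (\<xi> m) v) \<longlonglongrightarrow> 0)"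

lemma bounded_rangeD:
  fixes \<xi> :: "nat \<Rightarrow> 'a::real_normed_vector"
  assumes "bounded (range \<xi>)"
  obtains B where "0 < B" "\<And>m. norm (\<xi> m) \<le> B"
  using assms bounded_pos by (metis UNIV_I image_eqI)

text \<open>Boundedness allows the test vector to be replaced by a truncation up to a uniformly
  small error, and on a truncation finitely many coordinates decide.\<close>

lemma weakly_nullI_coordinates:
  assumes bd: "bounded (range \<xi>)" and c: "\<And>n. (\<lambda>m. seq_of (\<xi> m) n) \<longlonglongrightarrow> 0"
  shows "weakly_null \<xi>"
  unfolding weakly_null_def
proof (intro conjI allI bd)
  fix v
  obtain B where B: "0 < B" "\<And>m. norm (\<xi> m) \<le> B" using bounded_rangeD[OF bd] by blast
  show "(\<lambda>m. cinner (\<xi> m) v) \<longlonglongrightarrow> 0"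
  proof (rule LIMSEQ_I)
    fix e :: real assume e: "0 < e"
    then have "0 < e / (2 * B)" using B by simp
    from LIMSEQ_D[OF fvec_tendsto this, of v] obtain N
      where N: "norm (fvec N (seq_of v) - v) < e / (2 * B)" by blast
    let ?w = "fvec N (seq_of v)"
    have "(\<lambda>m. \<Sum>n<N. cnj (seq_of v n) * seq_of (\<xi> m) n) \<longlonglongrightarrow> (\<Sum>n<N. cnj (seq_of v n) * 0)"
      by (intro tendsto_intros c)
    then have "(\<lambda>m. cinner (\<xi> m) ?w) \<longlonglongrightarrow> 0"
      by (simp add: fvec_def cinner_simps cinner_ket_right)
    from LIMSEQ_D[OF this, of "e/2"] e obtain M where M: "\<And>m. m \<ge> M \<Longrightarrow> cmod (cinner (\<xi> m) ?w) < e/2"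
      by auto
    have "cmod (cinner (\<xi> m) v) < e" if "m \<ge> M" for m
    proof -
      have "cmod (cinner (\<xi> m) (?w - v)) \<le> B * (e / (2 * B))"
        by (rule order_trans[OF cmod_cinner_le]) (intro mult_mono B(2) less_imp_le[OF N], use B in auto)
      also have "\<dots> = e/2" using B by simp
      finally have "cmod (cinner (\<xi> m) ?w - cinner (\<xi> m) v) \<le> e/2" by (simp add: cinner_simps)
      moreover have "cmod (cinner (\<xi> m) v) \<le> cmod (cinner (\<xi> m) ?w)
          + cmod (cinner (\<xi> m) ?w - cinner (\<xi> m) v)"
        using norm_triangle_ineq4[of "cinner (\<xi> m) ?w" "cinner (\<xi> m) ?w - cinner (\<xi> m) v"] by simp
      ultimately show ?thesis using M[OF that] by linarith
    qed
    then show "\<exists>no. \<forall>n\<ge>no. norm (cinner (\<xi> n) v - 0) < e" by auto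
  qed
qed

lemma weakly_null_apply:
  assumes "weakly_null \<xi>" "T \<in> \<bbbB>"
  shows "weakly_null (\<lambda>m. T (\<xi> m))"
  unfolding weakly_null_def
proof (intro conjI allI)
  have "bounded (blinfun_apply T ` range \<xi>)"
    using assms(1) by (intro bounded_linear_image blinfun.bounded_linear_right) (simp add: weakly_null_def)
  then show "bounded (range (\<lambda>m. T (\<xi> m)))" by (simp add: image_image)
  show "(\<lambda>m. cinner (T (\<xi> m)) v) \<longlonglongrightarrow> 0" for v
    using assms(1) by (simp add: adj_props(3)[OF assms(2)] weakly_null_def)
qed

lemma weakly_null_scaleC:
  assumes "weakly_null \<xi>"
  shows "weakly_null (\<lambda>m. c *\<^sub>C \<xi> m)"
proof -
  have "c *\<^sub>O id_blinfun \<in> \<bbbB>" by (simp add: bounded_ops_def scaleC_simps mult.commute)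
  from weakly_null_apply[OF assms this] show ?thesis by simp
qed

lemma weakly_null_add:
  assumes "weakly_null \<xi>" "weakly_null \<eta>"
  shows "weakly_null (\<lambda>m. \<xi> m + \<eta> m)"
  unfolding weakly_null_def
proof (intro conjI allI)
  show "bounded (range (\<lambda>m. \<xi> m + \<eta> m))"
    using assms by (intro bounded_plus_comp) (auto simp: weakly_null_def)
  show "(\<lambda>m. cinner (\<xi> m + \<eta> m) v) \<longlonglongrightarrow> 0" for v
    using assms by (auto simp: weakly_null_def cinner_simps intro!: tendsto_add_zero)
qed

lemma weakly_null_subseq:
  assumes "weakly_null \<xi>" "strict_mono r"
  shows "weakly_null (\<xi> \<circ> r)"
  unfolding weakly_null_def
proof (intro conjI allI)
  show "bounded (range (\<xi> \<circ> r))"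
    using assms by (auto simp: weakly_null_def intro: bounded_subset)
  show "(\<lambda>m. cinner ((\<xi> \<circ> r) m) v) \<longlonglongrightarrow> 0" for v
    using assms LIMSEQ_subseq_LIMSEQ[of "\<lambda>m. cinner (\<xi> m) v" 0 r]
    by (auto simp: weakly_null_def o_def)
qed

lemma weakly_null_limit:
  assumes "weakly_null \<xi>" "\<xi> \<longlonglongrightarrow> w"
  shows "w = 0"
proof -
  have "(\<lambda>m. cinner (\<xi> m) w) \<longlonglongrightarrow> cinner w w" by (intro tendsto_cinner assms tendsto_const)
  moreover have "(\<lambda>m. cinner (\<xi> m) w) \<longlonglongrightarrow> 0" using assms by (simp add: weakly_null_def)
  ultimately have "cinner w w = 0" by (rule LIMSEQ_unique)
  then show ?thesis by (simp add: cinner_self)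
qed

lemma not_tendsto_zero_subseq:
  fixes f :: "nat \<Rightarrow> 'a::real_normed_vector"
  assumes "\<not> f \<longlonglongrightarrow> 0"
  obtains r :: "nat \<Rightarrow> nat" and e where "strict_mono r" "0 < e" "\<And>m. e \<le> norm (f (r m))"
proof -
  obtain e where e: "0 < e" "\<And>M. \<exists>m\<ge>M. e \<le> norm (f m)"
    using assms unfolding LIMSEQ_iff by (auto simp: not_less)
  then have "\<exists>\<^sub>\<infinity>m. e \<le> norm (f m)" by (auto simp: INFM_nat_le)
  then have "infinite {m. e \<le> norm (f m)}" by (simp add: frequently_cofinite)
  from infinite_enumerate[OF this] obtain r :: "nat \<Rightarrow> nat"
    where "strict_mono r" "\<forall>m. r m \<in> {m. e \<le> norm (f m)}" by blast
  then show thesis using that[of r e] e by simp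
qed

text \<open>A subsequence of images staying away from 0 would, after division by the bound
  \<open>B\<close>, lie in the image of the unit ball and have a norm-convergent subsequence. Its
  limit is also the weak limit, which is 0.\<close>

lemma compact_ops_weakly_null:
  assumes K: "K \<in> \<bbbK>" and \<xi>: "weakly_null \<xi>"
  shows "(\<lambda>m. K (\<xi> m)) \<longlonglongrightarrow> 0"
proof (rule ccontr)
  assume "\<not> ?thesis"
  then obtain r :: "nat \<Rightarrow> nat" and e where r: "strict_mono r" "0 < e" "\<And>m. e \<le> norm (K (\<xi> (r m)))"
    by (rule not_tendsto_zero_subseq) (rule that; assumption)
  have "bounded (range \<xi>)" using \<xi> by (simp add: weakly_null_def)
  then obtain B where B: "0 < B" "\<And>m. norm (\<xi> m) \<le> B" using bounded_rangeD by blast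
  define \<zeta> where "\<zeta> = (\<lambda>m. (1/B) *\<^sub>R K (\<xi> (r m)))"
  have "\<zeta> m \<in> closure (blinfun_apply K ` cball 0 1)" for m
  proof -
    have "\<zeta> m = K ((1/B) *\<^sub>R \<xi> (r m))" by (simp add: \<zeta>_def blinfun.scaleR_right)
    moreover have "(1/B) *\<^sub>R \<xi> (r m) \<in> cball 0 1" using B by (simp add: divide_le_eq)
    ultimately show ?thesis by (intro subsetD[OF closure_subset] image_eqI)
  qed
  moreover have "compact (closure (blinfun_apply K ` cball 0 1))"
    using K by (simp add: compact_ops_def)
  ultimately obtain w q where q: "strict_mono q" "(\<zeta> \<circ> q) \<longlonglongrightarrow> w"
    unfolding compact_def by meson
  have "weakly_null (\<zeta> \<circ> q)"
  proof (intro weakly_null_subseq q)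
    have "weakly_null (\<lambda>m. complex_of_real (1/B) *\<^sub>C K ((\<xi> \<circ> r) m))"
      using K \<xi> r by (intro weakly_null_scaleC weakly_null_apply weakly_null_subseq)
        (auto simp: compact_ops_def)
    then show "weakly_null \<zeta>" by (simp only: \<zeta>_def scaleR_ell2_scaleC o_def)
  qed
  then have "w = 0" using q weakly_null_limit by blast
  then have "(\<lambda>m. norm ((\<zeta> \<circ> q) m)) \<longlonglongrightarrow> 0" using q tendsto_norm_zero by blast
  moreover have "e / B \<le> norm ((\<zeta> \<circ> q) m)" for m
    using r(3)[of "q m"] B by (simp add: \<zeta>_def divide_right_mono)
  ultimately have "e / B \<le> 0" by (intro tendsto_lowerbound) auto
  then show False using r B by (simp add: divide_le_0_iff)
qed

text \<open>Tychonoff's theorem, applied below to the coordinates of a vector, to all complex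
  sequences at once and to the entries of matrix tuples.\<close>

lemma compact_PiE_UNIV:
  fixes K :: "'i \<Rightarrow> 'a::topological_space set"
  assumes "\<And>i. compact (K i)"
  shows "compact (PiE UNIV K)"
proof -
  have "compactin (product_topology (\<lambda>i. euclidean) UNIV) (PiE UNIV K)"
    using assms by (subst compactin_PiE) auto
  then show ?thesis by (simp add: euclidean_product_topology)
qed

text \<open>The diagonal argument is hidden in the sequential compactness of a countable product of
  discs. The coordinatewise limit is square-summable by the bound on partial sums.\<close>

lemma bounded_weakly_convergent_subseq:
  fixes h :: "nat \<Rightarrow> ell2"
  assumes B: "\<And>m. norm (h m) \<le> B"
  obtains r w where "strict_mono r" "weakly_null (\<lambda>m. h (r m) - w)"
proof -
  have B0: "0 \<le> B" using B[of 0] norm_ge_zero order_trans by blast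
  have "seq_compact (PiE UNIV (\<lambda>n::nat. cball (0::complex) B))"
    by (intro compact_imp_seq_compact compact_PiE_UNIV compact_cball)
  moreover have "seq_of (h m) \<in> PiE UNIV (\<lambda>n::nat. cball (0::complex) B)" for m
    using cmod_seq_of_le B order_trans by (auto simp: PiE_UNIV_domain) blast
  ultimately obtain f r where r: "strict_mono r" "((\<lambda>m. seq_of (h m)) \<circ> r) \<longlonglongrightarrow> f"
    unfolding seq_compact_def by meson
  have f: "(\<lambda>m. seq_of (h (r m)) n) \<longlonglongrightarrow> f n" for n
    using continuous_on_tendsto_compose[OF continuous_on_product_coordinates[of n] r(2)] by (simp add: o_def)
  have "(\<Sum>n<N. (cmod (f n))\<^sup>2) \<le> B\<^sup>2" for N
  proof (rule tendsto_upperbound)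
    show "(\<lambda>m. \<Sum>n<N. (cmod (seq_of (h (r m)) n))\<^sup>2) \<longlonglongrightarrow> (\<Sum>n<N. (cmod (f n))\<^sup>2)"
      by (intro tendsto_intros f)
    show "\<forall>\<^sub>F m in sequentially. (\<Sum>n<N. (cmod (seq_of (h (r m)) n))\<^sup>2) \<le> B\<^sup>2"
      by (intro always_eventually allI order_trans[OF ell2_partial_sum_le] power_mono B) simp
  qed simp
  then obtain w where w: "seq_of w = f" "norm w \<le> B" using ell2_from_bounded_sums B0 by blast
  have "weakly_null (\<lambda>m. h (r m) - w)"
  proof (rule weakly_nullI_coordinates)
    show "bounded (range (\<lambda>m. h (r m) - w))"
      by (intro bounded_minus_comp boundedI[of _ B]) (auto simp: B w)
    show "(\<lambda>m. seq_of (h (r m) - w) n) \<longlonglongrightarrow> 0" for n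
      using f[of n] by (simp add: seq_of_minus w LIM_zero_iff)
  qed
  then show thesis using r that by blast
qed

text \<open>Points of the closure are approximated by values \<open>T (h n)\<close>. Along a
  subsequence \<open>h\<close> converges weakly to some \<open>w\<close>, and the hypothesis for
  \<open>h (r m) - w\<close> makes \<open>T (h (r m))\<close> converge to \<open>T w\<close> in
  norm. Compactness of \<open>R\<close> and of every \<open>k j\<close> is proved through this
  criterion.\<close>

lemma compact_opsI_weakly_null:
  assumes T: "T \<in> \<bbbB>" and null: "\<And>\<xi>. weakly_null \<xi> \<Longrightarrow> (\<lambda>m. T (\<xi> m)) \<longlonglongrightarrow> 0"
  shows "T \<in> \<bbbK>"
proof -
  have "compact (closure (blinfun_apply T ` cball 0 1))"
    unfolding compact_def
  proof (intro allI impI)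
    fix f :: "nat \<Rightarrow> ell2" assume f: "\<forall>n. f n \<in> closure (blinfun_apply T ` cball 0 1)"
    have "\<exists>h. norm h \<le> 1 \<and> dist (T h) (f n) < inverse (real (Suc n))" for n
      using f[rule_format, of n, unfolded closure_approachable, rule_format, of "inverse (real (Suc n))"] by auto
    then have "\<exists>h. \<forall>n. norm (h n) \<le> 1 \<and> dist (T (h n)) (f n) < inverse (real (Suc n))"
      by (intro choice allI)
    then obtain h where h': "\<forall>n. norm (h n) \<le> 1 \<and> dist (T (h n)) (f n) < inverse (real (Suc n))" ..
    then have h: "\<And>n. norm (h n) \<le> 1" "\<And>n. dist (T (h n)) (f n) < inverse (real (Suc n))"
      by auto
    obtain r w where r: "strict_mono r" "weakly_null (\<lambda>m. h (r m) - w)"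
      by (rule bounded_weakly_convergent_subseq[OF h(1)]) (rule that; assumption)
    have "(\<lambda>n. f n - T (h n)) \<longlonglongrightarrow> 0"
    proof (rule Lim_null_comparison[OF _ LIMSEQ_inverse_real_of_nat])
      show "\<forall>\<^sub>F n in sequentially. norm (f n - T (h n)) \<le> inverse (real (Suc n))"
        using h(2) by (intro always_eventually allI less_imp_le) (simp add: dist_norm norm_minus_commute)
    qed
    then have "(\<lambda>n. f (r n) - T (h (r n))) \<longlonglongrightarrow> 0"
      using LIMSEQ_subseq_LIMSEQ[of "\<lambda>n. f n - T (h n)" 0 r] r(1) by (simp add: o_def)
    moreover have "(\<lambda>n. T (h (r n))) \<longlonglongrightarrow> T w"
      using null[OF r(2)] by (simp add: blinfun.diff_right LIM_zero_iff)
    ultimately have "(\<lambda>n. (f (r n) - T (h (r n))) + T (h (r n))) \<longlonglongrightarrow> 0 + T w"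
      by (rule tendsto_add)
    then have *: "(f \<circ> r) \<longlonglongrightarrow> T w" by (simp add: o_def)
    moreover have "T w \<in> closure (blinfun_apply T ` cball 0 1)"
      using closed_sequentially[OF closed_closure _ *] f by simp
    ultimately show "\<exists>l\<in>closure (blinfun_apply T ` cball 0 1). \<exists>r. strict_mono r \<and> (f \<circ> r) \<longlonglongrightarrow> l"
      using r by blast
  qed
  then show ?thesis using T by (simp add: compact_ops_def)
qed

lemma symm_op_iff_cinner:
  assumes "T \<in> \<bbbB>" "\<And>x y. cinner (blinfun_apply T x) y = cinner x (T y)"
  shows "symm_op T"
  using assms(2) by (simp add: symm_op_def inner_ell2_def)

text \<open>For \<open>\<eta>\<close> weakly null with \<open>R \<eta>\<close> bounded away from \<open>0\<close>, Cauchy-Schwarz for the form of \<open>R\<close>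
  gives \<open>\<parallel>R \<eta>\<parallel>\<^sup>4 \<le> \<langle>R \<eta>, \<eta>\<rangle> \<langle>R\<^sup>3 \<eta>, \<eta>\<rangle>\<close>, and \<open>R\<^sup>3 = R A R\<close>.\<close>

lemma compact_positive_part:
  assumes R: "R \<in> \<bbbB>" "pos_op R" "R o\<^sub>L R = A o\<^sub>L R"
    and no: "\<And>\<xi> \<delta>. weakly_null \<xi> \<Longrightarrow> 0 < \<delta> \<Longrightarrow> (\<And>m. \<delta> \<le> inner (blinfun_apply A (\<xi> m)) (\<xi> m)) \<Longrightarrow> False"
  shows "R \<in> \<bbbK>"
proof (rule compact_opsI_weakly_null[OF R(1)], rule ccontr)
  fix \<eta> assume \<eta>: "weakly_null \<eta>" and "\<not> (\<lambda>m. R (\<eta> m)) \<longlonglongrightarrow> 0"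
  from this(2) obtain r :: "nat \<Rightarrow> nat" and e where r: "strict_mono r" "0 < e" "\<And>m. e \<le> norm (R (\<eta> (r m)))"
    by (rule not_tendsto_zero_subseq) (rule that; assumption)
  define \<zeta> where "\<zeta> = \<eta> \<circ> r"
  have \<zeta>: "weakly_null \<zeta>" unfolding \<zeta>_def by (rule weakly_null_subseq[OF \<eta> r(1)])
  then obtain B where B: "0 < B" "\<And>m. norm (\<zeta> m) \<le> B"
    using bounded_rangeD weakly_null_def by blast
  define c where "c = norm R * B\<^sup>2 + 1"
  have c: "0 < c" by (auto simp: c_def intro!: add_nonneg_pos)
  \<comment> \<open>The sequence offered to \<open>no\<close> is \<open>R \<zeta>\<close>: on the
    range of \<open>R\<close>, the operators \<open>A\<close> and \<open>R\<close> agree.\<close>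
  have "e ^ 4 / c \<le> inner (A (R (\<zeta> m))) (R (\<zeta> m))" for m
  proof -
    let ?u = "\<zeta> m"
    have "inner (R ?u) ?u \<le> norm R * inner ?u ?u" by (rule inner_blinfun_le)
    also have "\<dots> \<le> norm R * B\<^sup>2"
      using B by (auto simp: power2_norm_eq_inner[symmetric] intro!: mult_left_mono power_mono)
    finally have 1: "inner (R ?u) ?u \<le> c" by (simp add: c_def)
    have 2: "A (R ?u) = R (R ?u)" using R(3) by (simp add: blinfun_eq_iff)
    have 3: "0 \<le> inner (R (R ?u)) (R ?u)" using R(2) by (simp add: pos_op_def)
    have "e ^ 4 \<le> (norm (R ?u)) ^ 4"
      using r by (intro power_mono) (auto simp: \<zeta>_def)
    also have "\<dots> = (inner (R ?u) (R ?u))\<^sup>2" by (simp add: power2_norm_eq_inner[symmetric])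
    also have "\<dots> \<le> inner (R ?u) ?u * inner (R (R ?u)) (R ?u)"
      by (rule pos_op_Cauchy_Schwarz[OF R(2)])
    also have "\<dots> \<le> c * inner (R (R ?u)) (R ?u)" by (intro mult_right_mono 1 3)
    finally show ?thesis using c by (simp add: 2 divide_le_eq mult.commute)
  qed
  moreover have "weakly_null (\<lambda>m. R (\<zeta> m))" by (rule weakly_null_apply[OF \<zeta> R(1)])
  moreover have "0 < e ^ 4 / c" using r c by simp
  ultimately show False using no by blast
qed

section \<open>Asymptotic compressions\<close>

text \<open>It stands in for a free ultrafilter: limits of all bounded sequences exist
  simultaneously and respect sums and products, so they define a map on a whole operator algebra. A
  convergent subsequence would depend on the operator.\<close>

definition limit_filter :: "nat filter \<Rightarrow> bool" where
  "limit_filter F \<longleftrightarrow> F \<noteq> bot \<and> F \<le> sequentially \<and>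
    (\<forall>f :: nat \<Rightarrow> complex. bounded (range f) \<longrightarrow> (\<exists>l. (f \<longlongrightarrow> l) F))"

text \<open>A cluster point of the sequence \<open>m \<mapsto> (f \<mapsto> f m)\<close> in the compact product, over all
  bounded \<open>f\<close>, of the discs containing their values.\<close>

lemma limit_filter_exists: "\<exists>F. limit_filter F"
proof -
  define B where "B f = (SOME b. \<forall>m. cmod (f m) \<le> b)" for f :: "nat \<Rightarrow> complex"
  \<comment> \<open>Unbounded sequences are sent to 0, so that \<open>g m\<close> lies in a product
    of discs indexed by all sequences.\<close>
  define g where "g m f = (if bounded (range f) then f m else 0)" for m and f :: "nat \<Rightarrow> complex"
  define C where "C f = (if bounded (range f) then B f else 0)" for f :: "nat \<Rightarrow> complex"
  have B: "cmod (f m) \<le> B f" if "bounded (range f)" for f m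
  proof -
    have "\<exists>b. \<forall>m. cmod (f m) \<le> b" using that by (auto simp: bounded_iff)
    from someI_ex[OF this] show ?thesis by (simp add: B_def)
  qed
  have "g m \<in> PiE UNIV (\<lambda>f. cball (0::complex) (C f))" for m
    by (auto simp: g_def C_def B)
  then have "eventually (\<lambda>y. y \<in> PiE UNIV (\<lambda>f. cball (0::complex) (C f))) (filtermap g sequentially)"
    by (simp add: eventually_filtermap)
  moreover have "filtermap g sequentially \<noteq> bot" by (simp add: filtermap_bot_iff)
  moreover have "compact (PiE UNIV (\<lambda>f. cball (0::complex) (C f)))" by (intro compact_PiE_UNIV compact_cball)
  ultimately obtain x where x: "inf (nhds x) (filtermap g sequentially) \<noteq> bot"
    unfolding compact_filter by blast
  \<comment> \<open>Pulling back the neighbourhoods of \<open>x\<close> makes \<open>g\<close>, and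
    with it each bounded sequence, converge along \<open>F\<close>. That \<open>x\<close> is a
    cluster point makes \<open>F\<close> nontrivial.\<close>
  define F where "F = inf sequentially (filtercomap g (nhds x))"
  have "F \<noteq> bot"
  proof
    assume "F = bot"
    then have "eventually (\<lambda>_. False) F" by simp
    then obtain P Q where PQ: "eventually P sequentially" "eventually Q (filtercomap g (nhds x))"
      "\<And>m. P m \<Longrightarrow> Q m \<Longrightarrow> False"
      unfolding F_def eventually_inf by blast
    obtain Q' where Q': "eventually Q' (nhds x)" "\<And>m. Q' (g m) \<Longrightarrow> Q m"
      using PQ(2) unfolding eventually_filtercomap by blast
    have "eventually (\<lambda>y. \<not> Q' y) (filtermap g sequentially)"
      unfolding eventually_filtermap using PQ(1) by (rule eventually_mono) (use PQ(3) Q'(2) in blast)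
    then have "eventually (\<lambda>_. False) (inf (nhds x) (filtermap g sequentially))"
      unfolding eventually_inf using Q'(1) by blast
    then show False using x by (simp add: trivial_limit_def)
  qed
  moreover have "F \<le> sequentially" by (simp add: F_def)
  moreover have "\<exists>l. (f \<longlongrightarrow> l) F" if f: "bounded (range f)" for f :: "nat \<Rightarrow> complex"
  proof -
    have "filterlim g (nhds x) F"
      unfolding F_def by (rule filterlim_mono[OF filterlim_filtercomap order_refl]) simp
    then have "((\<lambda>m. g m f) \<longlongrightarrow> x f) F"
      using continuous_on_tendsto_compose[OF continuous_on_product_coordinates[of f], of g x F] by simp
    then show ?thesis using f by (auto simp: g_def)
  qed
  ultimately show ?thesis unfolding limit_filter_def by blast
qed

lemma limit_filter_cinner:
  assumes F: "limit_filter F" and u: "bounded (range u)" and v: "bounded (range v)"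
  shows "\<exists>l. ((\<lambda>m. cinner (u m) (v m)) \<longlongrightarrow> l) F"
proof -
  obtain A where A: "0 < A" "\<And>m. norm (u m) \<le> A" by (rule bounded_rangeD[OF u]) (rule that; assumption)
  obtain B where B: "0 < B" "\<And>m. norm (v m) \<le> B" by (rule bounded_rangeD[OF v]) (rule that; assumption)
  have "bounded (range (\<lambda>m. cinner (u m) (v m)))"
    by (rule boundedI[of _ "A * B"])
      (use A B in \<open>auto intro!: order_trans[OF cmod_cinner_le] mult_mono\<close>)
  then show ?thesis using F unfolding limit_filter_def by auto
qed

section \<open>Gram-Schmidt orthogonalization along a filter\<close>

definition lincomb :: "nat \<Rightarrow> (nat \<Rightarrow> complex) \<Rightarrow> (nat \<Rightarrow> nat \<Rightarrow> ell2) \<Rightarrow> nat \<Rightarrow> ell2" where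
  "lincomb n c \<zeta> m = (\<Sum>r<n. c r *\<^sub>C \<zeta> r m)"

text \<open>Orthonormality is asked only of the limits along \<open>F\<close>, since the compression
  is itself a limit. Weak nullity is what lets the compression annihilate compact operators.\<close>

definition asymp_orthonormal :: "nat filter \<Rightarrow> nat \<Rightarrow> (nat \<Rightarrow> nat \<Rightarrow> ell2) \<Rightarrow> bool" where
  "asymp_orthonormal F n \<zeta> \<longleftrightarrow> (\<forall>r<n. weakly_null (\<zeta> r)) \<and>
    (\<forall>r<n. \<forall>s<n. ((\<lambda>m. cinner (\<zeta> r m) (\<zeta> s m)) \<longlongrightarrow> (if r = s then 1 else 0)) F)"

text \<open>The coefficients do not depend on \<open>m\<close>: in
  \<open>column_norm_violation\<close> they become the column of a matrix.\<close>

definition asymp_span :: "nat filter \<Rightarrow> nat \<Rightarrow> (nat \<Rightarrow> nat \<Rightarrow> ell2) \<Rightarrow> (nat \<Rightarrow> ell2) \<Rightarrow> bool" where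
  "asymp_span F n \<zeta> u \<longleftrightarrow> (\<exists>c. ((\<lambda>m. u m - lincomb n c \<zeta> m) \<longlongrightarrow> 0) F)"

lemma weakly_null_zero: "weakly_null (\<lambda>_. 0)"
  by (simp add: weakly_null_def cinner_zero)

lemma weakly_null_sum: "(\<And>i. i \<in> I \<Longrightarrow> weakly_null (f i)) \<Longrightarrow> weakly_null (\<lambda>m. \<Sum>i\<in>I. f i m)"
  by (induction I rule: infinite_finite_induct) (auto simp: weakly_null_zero intro!: weakly_null_add)

lemma weakly_null_lincomb: "asymp_orthonormal F n \<zeta> \<Longrightarrow> weakly_null (lincomb n c \<zeta>)"
  unfolding lincomb_def[abs_def]
  by (intro weakly_null_sum weakly_null_scaleC) (auto simp: asymp_orthonormal_def)

lemma weakly_null_diff: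
  assumes "weakly_null \<xi>" "weakly_null \<eta>"
  shows "weakly_null (\<lambda>m. \<xi> m - \<eta> m)"
  using weakly_null_add[OF assms(1) weakly_null_scaleC[OF assms(2), of "-1"]] by (simp add: scaleC_simps)

lemma weakly_null_bounded: "weakly_null \<xi> \<Longrightarrow> bounded (range \<xi>)"
  by (simp add: weakly_null_def)

lemma asymp_orthonormal_lincomb:
  assumes "asymp_orthonormal F n \<zeta>" "s < n"
  shows "((\<lambda>m. cinner (lincomb n c \<zeta> m) (\<zeta> s m)) \<longlongrightarrow> c s) F"
proof -
  have "((\<lambda>m. \<Sum>r<n. c r * cinner (\<zeta> r m) (\<zeta> s m)) \<longlongrightarrow> (\<Sum>r<n. c r * (if r = s then 1 else 0))) F"
    using assms by (intro tendsto_intros) (auto simp: asymp_orthonormal_def)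
  then show ?thesis using assms(2)
    by (simp add: lincomb_def cinner_simps if_distrib[of "\<lambda>z. _ * z"] cong: if_cong)
qed

lemma tendsto_cinner_null:
  fixes v :: "nat \<Rightarrow> ell2"
  assumes "(w \<longlongrightarrow> 0) F" "bounded (range v)"
  shows "((\<lambda>m. cinner (w m) (v m)) \<longlongrightarrow> 0) F"
proof -
  obtain B where B: "0 < B" "\<And>m. norm (v m) \<le> B" by (rule bounded_rangeD[OF assms(2)]) (rule that; assumption)
  show ?thesis
  proof (rule Lim_null_comparison)
    have "cmod (cinner (w m) (v m)) \<le> norm (w m) * B" for m
      by (rule order_trans[OF cmod_cinner_le]) (intro mult_left_mono B, simp)
    then show "\<forall>\<^sub>F m in F. norm (cinner (w m) (v m)) \<le> norm (w m) * B" by simp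
    show "((\<lambda>m. norm (w m) * B) \<longlongrightarrow> 0) F"
      by (intro tendsto_mult_left_zero tendsto_norm_zero assms)
  qed
qed

lemma asymp_coefficient:
  assumes \<zeta>: "asymp_orthonormal F n \<zeta>" and u: "((\<lambda>m. u m - lincomb n c \<zeta> m) \<longlongrightarrow> 0) F" and s: "s < n"
  shows "((\<lambda>m. cinner (u m) (\<zeta> s m)) \<longlongrightarrow> c s) F"
proof -
  have "((\<lambda>m. cinner (u m - lincomb n c \<zeta> m) (\<zeta> s m) + cinner (lincomb n c \<zeta> m) (\<zeta> s m)) \<longlongrightarrow> 0 + c s) F"
    using \<zeta> s
    by (intro tendsto_add tendsto_cinner_null u asymp_orthonormal_lincomb weakly_null_bounded)
      (auto simp: asymp_orthonormal_def)
  then show ?thesis by (simp add: cinner_simps)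
qed

text \<open>Parseval in the limit. Only the first argument of the inner product of \<open>u\<close>
  with itself is expanded, so that the error term is paired with a bounded sequence.\<close>

lemma asymp_norm:
  assumes \<zeta>: "asymp_orthonormal F n \<zeta>" and u: "((\<lambda>m. u m - lincomb n c \<zeta> m) \<longlongrightarrow> 0) F"
    and ub: "bounded (range u)"
  shows "((\<lambda>m. (norm (u m))\<^sup>2) \<longlongrightarrow> (\<Sum>r<n. (cmod (c r))\<^sup>2)) F"
proof -
  have "((\<lambda>m. cinner (u m - lincomb n c \<zeta> m) (u m) + (\<Sum>r<n. c r * cnj (cinner (u m) (\<zeta> r m))))
      \<longlongrightarrow> 0 + (\<Sum>r<n. c r * cnj (c r))) F"
    by (intro tendsto_add tendsto_cinner_null tendsto_sum tendsto_mult tendsto_cnj tendsto_const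
        asymp_coefficient[OF \<zeta> u] u ub) simp
  then have "((\<lambda>m. cinner (u m) (u m)) \<longlongrightarrow> (\<Sum>r<n. c r * cnj (c r))) F"
    by (simp add: lincomb_def cinner_simps cinner_commute[symmetric])
  then have "((\<lambda>m. Re (cinner (u m) (u m))) \<longlongrightarrow> Re (\<Sum>r<n. c r * cnj (c r))) F"
    by (rule tendsto_Re)
  then show ?thesis
    by (simp add: cinner_self cmod_power2 power2_eq_square[of "Re _"] power2_eq_square[of "Im _"])
qed

lemma asymp_span_mono:
  assumes "asymp_span F n \<zeta> u" "n \<le> n'" "\<And>r. r < n \<Longrightarrow> \<zeta>' r = \<zeta> r"
  shows "asymp_span F n' \<zeta>' u"
proof -
  obtain c where c: "((\<lambda>m. u m - lincomb n c \<zeta> m) \<longlongrightarrow> 0) F" using assms(1) asymp_span_def by blast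
  define c' where "c' r = (if r < n then c r else 0)" for r
  have "lincomb n' c' \<zeta>' m = lincomb n c \<zeta> m" for m
  proof -
    have "lincomb n' c' \<zeta>' m = (\<Sum>r<n. c' r *\<^sub>C \<zeta>' r m)"
      unfolding lincomb_def by (rule sum.mono_neutral_right) (use assms(2) in \<open>auto simp: c'_def scaleC_simps\<close>)
    also have "\<dots> = lincomb n c \<zeta> m"
      unfolding lincomb_def by (rule sum.cong) (auto simp: c'_def assms(3))
    finally show ?thesis .
  qed
  then show ?thesis using c unfolding asymp_span_def by (intro exI[of _ c']) simp
qed

text \<open>Once the limiting coefficients are removed, the residual \<open>w\<close> is
  asymptotically orthogonal to all \<open>\<zeta> r\<close>. If its norm tends to 0 along
  \<open>F\<close>, then \<open>u\<close> is in the span already and \<open>n' = n\<close>;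
  otherwise the rescaled \<open>w\<close> becomes the next vector.\<close>

lemma asymp_Gram_Schmidt_step:
  assumes F: "limit_filter F" and \<zeta>: "asymp_orthonormal F n \<zeta>" and u: "weakly_null u"
  obtains n' :: nat and \<zeta>' where "n \<le> n'" "asymp_orthonormal F n' \<zeta>'" "\<And>r. r < n \<Longrightarrow> \<zeta>' r = \<zeta> r"
    "asymp_span F n' \<zeta>' u"
proof -
  have "\<exists>l. ((\<lambda>m. cinner (u m) (\<zeta> r m)) \<longlongrightarrow> l) F" if "r < n" for r
    using limit_filter_cinner[OF F weakly_null_bounded[OF u] weakly_null_bounded, of "\<zeta> r"] \<zeta> that
    unfolding asymp_orthonormal_def by auto
  then have "\<exists>c. \<forall>r. r < n \<longrightarrow> ((\<lambda>m. cinner (u m) (\<zeta> r m)) \<longlongrightarrow> c r) F"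
    by (intro choice) auto
  then obtain c where c: "\<forall>r. r < n \<longrightarrow> ((\<lambda>m. cinner (u m) (\<zeta> r m)) \<longlongrightarrow> c r) F" ..
  define w where "w m = u m - lincomb n c \<zeta> m" for m
  have w: "weakly_null w"
    unfolding w_def[abs_def] by (intro weakly_null_diff u weakly_null_lincomb[OF \<zeta>])
  have w\<zeta>: "((\<lambda>m. cinner (w m) (\<zeta> s m)) \<longlongrightarrow> 0) F" if s: "s < n" for s
    using tendsto_diff[OF c[rule_format, OF s] asymp_orthonormal_lincomb[OF \<zeta> s, of c]]
    by (simp add: w_def cinner_simps)
  obtain l where l: "((\<lambda>m. cinner (w m) (w m)) \<longlongrightarrow> l) F"
    using limit_filter_cinner[OF F weakly_null_bounded[OF w] weakly_null_bounded[OF w]] by blast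
  have L: "((\<lambda>m. (norm (w m))\<^sup>2) \<longlongrightarrow> Re l) F"
    using tendsto_Re[OF l] by (simp add: cinner_self)
  have "Re l \<ge> 0"
    using F by (intro tendsto_lowerbound[OF L]) (auto simp: limit_filter_def)
  then consider "Re l = 0" | "Re l > 0" by linarith
  then show thesis
  proof cases
    case 1
    have "(w \<longlongrightarrow> 0) F"
      using tendsto_real_sqrt[OF L] 1 by (simp add: tendsto_norm_zero_iff)
    then have "asymp_span F n \<zeta> u" unfolding asymp_span_def w_def by blast
    then show thesis using that[of n \<zeta>] \<zeta> by simp
  next
    case 2
    \<comment> \<open>One constant for all \<open>m\<close>: dividing by the norm of
      \<open>w m\<close> itself could fail at zeros and would make the coefficients depend on
      \<open>m\<close>.\<close>
    define a where "a = complex_of_real (sqrt (Re l))"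
    have a: "a \<noteq> 0" using 2 by (simp add: a_def)
    have aa: "a * cnj a = complex_of_real (Re l)"
      using 2 by (simp add: a_def flip: of_real_mult)
    have ll: "l = complex_of_real (Re l)"
    proof -
      have "((\<lambda>m. complex_of_real ((norm (w m))\<^sup>2)) \<longlongrightarrow> complex_of_real (Re l)) F"
        by (intro tendsto_of_real L)
      then show ?thesis using l F unfolding cinner_self limit_filter_def
        using tendsto_unique by blast
    qed
    define \<zeta>' where "\<zeta>' r = (if r < n then \<zeta> r else (\<lambda>m. (1/a) *\<^sub>C w m))" for r
    have ww: "((\<lambda>m. cinner (\<zeta>' n m) (\<zeta>' n m)) \<longlongrightarrow> 1) F"
    proof -
      have "((\<lambda>m. (1 / (a * cnj a)) * cinner (w m) (w m)) \<longlongrightarrow> (1 / (a * cnj a)) * l) F"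
        by (intro tendsto_intros l)
      moreover have "(1 / (a * cnj a)) * l = 1"
        unfolding aa by (subst ll) (use 2 in simp)
      ultimately show ?thesis by (simp add: \<zeta>'_def cinner_simps mult.commute)
    qed
    have w1: "((\<lambda>m. cinner (\<zeta>' n m) (\<zeta>' s m)) \<longlongrightarrow> 0) F" if "s < n" for s
      using tendsto_mult[OF tendsto_const w\<zeta>[OF that], of "1/a"] that by (simp add: \<zeta>'_def cinner_simps)
    have w2: "((\<lambda>m. cinner (\<zeta>' s m) (\<zeta>' n m)) \<longlongrightarrow> 0) F" if "s < n" for s
      using tendsto_cnj[OF w1[OF that]] by (simp add: cinner_commute[symmetric])
    have "asymp_orthonormal F (Suc n) \<zeta>'"
      unfolding asymp_orthonormal_def
    proof (intro conjI allI impI)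
      fix r assume "r < Suc n"
      show "weakly_null (\<zeta>' r)"
        using \<zeta> w by (auto simp: \<zeta>'_def asymp_orthonormal_def intro: weakly_null_scaleC)
      fix s assume "s < Suc n"
      show "((\<lambda>m. cinner (\<zeta>' r m) (\<zeta>' s m)) \<longlongrightarrow> (if r = s then 1 else 0)) F"
      proof (cases "r = n"; cases "s = n")
        assume "r \<noteq> n" "s \<noteq> n"
        then have "r < n" "s < n" using \<open>r < Suc n\<close> \<open>s < Suc n\<close> by auto
        then show ?thesis using \<zeta> by (simp add: asymp_orthonormal_def \<zeta>'_def)
      qed (use ww w1 w2 \<open>r < Suc n\<close> \<open>s < Suc n\<close> in auto)
    qed
    moreover have "asymp_span F (Suc n) \<zeta>' u"
    proof -
      have "lincomb (Suc n) (c(n := a)) \<zeta>' m = u m" for m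
      proof -
        have "lincomb (Suc n) (c(n := a)) \<zeta>' m = lincomb n c \<zeta> m + a *\<^sub>C \<zeta>' n m"
          by (simp add: lincomb_def \<zeta>'_def)
        then show ?thesis using a by (simp add: \<zeta>'_def scaleC_simps w_def)
      qed
      then show ?thesis unfolding asymp_span_def by (intro exI[of _ "c(n := a)"]) simp
    qed
    ultimately show thesis using that[of "Suc n" \<zeta>'] by (simp add: \<zeta>'_def)
  qed
qed

text \<open>Keeping the old vectors has two uses: spans already reached stay valid, and in
  \<open>column_norm_violation\<close> the sequence \<open>\<zeta> 0\<close> remains the normalized
  \<open>\<xi>\<close>.\<close>

lemma asymp_Gram_Schmidt:
  fixes k :: nat
  assumes F: "limit_filter F" and \<zeta>: "asymp_orthonormal F n \<zeta>" and u: "\<And>i. i < k \<Longrightarrow> weakly_null (u i)"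
  shows "\<exists>n' \<zeta>'. n \<le> n' \<and> asymp_orthonormal F n' \<zeta>' \<and> (\<forall>r<n. \<zeta>' r = \<zeta> r) \<and>
    (\<forall>i<k. asymp_span F n' \<zeta>' (u i))"
  using u
proof (induction k)
  case 0
  then show ?case using \<zeta> by auto
next
  case (Suc k)
  then obtain n1 \<zeta>1 where 1: "n \<le> n1" "asymp_orthonormal F n1 \<zeta>1" "\<forall>r<n. \<zeta>1 r = \<zeta> r"
    "\<forall>i<k. asymp_span F n1 \<zeta>1 (u i)" by auto
  have uk: "weakly_null (u k)" using Suc.prems by simp
  obtain n2 :: nat and \<zeta>2 where 2: "n1 \<le> n2" "asymp_orthonormal F n2 \<zeta>2" "\<And>r. r < n1 \<Longrightarrow> \<zeta>2 r = \<zeta>1 r"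
    "asymp_span F n2 \<zeta>2 (u k)"
    by (rule asymp_Gram_Schmidt_step[OF F 1(2) uk]) (rule that; assumption)
  have "asymp_span F n2 \<zeta>2 (u i)" if "i < Suc k" for i
    using that 1(4) 2 asymp_span_mono[of F n1 \<zeta>1 "u i" n2 \<zeta>2] by (auto simp: less_Suc_eq)
  then show ?case using 1 2 by (intro exI[of _ n2] exI[of _ \<zeta>2]) auto
qed

section \<open>Inner products and adjoints of finite matrices\<close>

definition vnorm2 :: "complex vec \<Rightarrow> real" where
  "vnorm2 v = (\<Sum>r<dim_vec v. (cmod (v $ r))\<^sup>2)"

lemma cscalar_prod_sum:
  assumes "w \<in> carrier_vec n"
  shows "u \<bullet>c w = (\<Sum>r<n. u $ r * cnj (w $ r))"
  using assms by (auto simp: scalar_prod_def lessThan_atLeast0 intro!: sum.cong)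

lemma mult_mat_vec_index:
  assumes "A \<in> carrier_mat m n" "v \<in> carrier_vec n" "r < m"
  shows "(A *\<^sub>v v) $ r = (\<Sum>s<n. A $$ (r, s) * v $ s)"
  using assms by (auto simp: scalar_prod_def lessThan_atLeast0 intro!: sum.cong)

lemma cscalar_prod_self: "v \<bullet>c v = complex_of_real (vnorm2 v)"
  unfolding cscalar_prod_sum[OF carrier_vec_dim_vec] vnorm2_def of_real_sum
  by (simp only: complex_norm_square)

lemma index_mat_adjoint:
  assumes "A \<in> carrier_mat m n" "i < n" "j < m"
  shows "mat_adjoint A $$ (i, j) = cnj (A $$ (j, i))"
  using assms unfolding mat_adjoint_def by (simp add: mat_of_rows_index)

lemma mat_adjoint_carrier: "A \<in> carrier_mat m n \<Longrightarrow> mat_adjoint A \<in> carrier_mat n m"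
  unfolding mat_adjoint_def by auto

lemma mat_adjoint_cscalar_prod:
  fixes A :: "complex mat"
  assumes A: "A \<in> carrier_mat m n" and w: "w \<in> carrier_vec m" and v: "v \<in> carrier_vec n"
  shows "(mat_adjoint A *\<^sub>v w) \<bullet>c v = w \<bullet>c (A *\<^sub>v v)"
proof -
  have Av: "A *\<^sub>v v \<in> carrier_vec m" by (rule mult_mat_vec_carrier[OF A v])
  have "(mat_adjoint A *\<^sub>v w) \<bullet>c v = (\<Sum>i<n. (\<Sum>j<m. cnj (A $$ (j, i)) * w $ j) * cnj (v $ i))"
    unfolding cscalar_prod_sum[OF v]
    by (rule sum.cong)
      (auto simp: mult_mat_vec_index[OF mat_adjoint_carrier[OF A] w] index_mat_adjoint[OF A])
  also have "\<dots> = (\<Sum>j<m. w $ j * cnj (\<Sum>i<n. A $$ (j, i) * v $ i))"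
    by (simp add: sum_distrib_left sum_distrib_right mult_ac) (rule sum.swap)
  also have "\<dots> = w \<bullet>c (A *\<^sub>v v)"
    unfolding cscalar_prod_sum[OF Av] by (rule sum.cong) (auto simp: mult_mat_vec_index[OF A v])
  finally show ?thesis .
qed

lemma mat_sum_carrier: "mat_sum n f I \<in> carrier_mat n n"
  by (simp add: mat_sum_def)

lemma mat_sum_mult_vec_index:
  assumes f: "\<And>i. i \<in> I \<Longrightarrow> f i \<in> carrier_mat n n" and v: "v \<in> carrier_vec n" and r: "r < n"
  shows "(mat_sum n f I *\<^sub>v v) $ r = (\<Sum>i\<in>I. (f i *\<^sub>v v) $ r)"
proof -
  have "(mat_sum n f I *\<^sub>v v) $ r = (\<Sum>s<n. (\<Sum>i\<in>I. f i $$ (r, s)) * v $ s)"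
    unfolding mult_mat_vec_index[OF mat_sum_carrier v r] by (rule sum.cong) (auto simp: mat_sum_def r)
  also have "\<dots> = (\<Sum>i\<in>I. \<Sum>s<n. f i $$ (r, s) * v $ s)"
    by (simp add: sum_distrib_right) (rule sum.swap)
  also have "\<dots> = (\<Sum>i\<in>I. (f i *\<^sub>v v) $ r)"
    by (rule sum.cong) (auto simp: mult_mat_vec_index[OF f v r])
  finally show ?thesis .
qed

lemma mat_sum_cscalar_prod:
  assumes f: "\<And>i. i \<in> I \<Longrightarrow> f i \<in> carrier_mat n n" and v: "v \<in> carrier_vec n" and w: "w \<in> carrier_vec n"
  shows "(mat_sum n f I *\<^sub>v v) \<bullet>c w = (\<Sum>i\<in>I. (f i *\<^sub>v v) \<bullet>c w)"
proof -
  have "(mat_sum n f I *\<^sub>v v) \<bullet>c w = (\<Sum>r<n. (\<Sum>i\<in>I. (f i *\<^sub>v v) $ r) * cnj (w $ r))"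
    unfolding cscalar_prod_sum[OF w]
    by (rule sum.cong) (auto simp: mat_sum_mult_vec_index[OF f v])
  also have "\<dots> = (\<Sum>i\<in>I. (f i *\<^sub>v v) \<bullet>c w)"
    unfolding cscalar_prod_sum[OF w] by (simp add: sum_distrib_right) (rule sum.swap)
  finally show ?thesis .
qed

text \<open>The quadratic form of the difference at \<open>v\<close> is the real number
  \<open>vnorm2 v\<close> minus the sum of the \<open>vnorm2 (c j *\<^sub>v v)\<close>. All later
  work on the ball uses this norm inequality instead of the matrix order.\<close>

lemma mat_le_one_iff:
  assumes c: "\<And>j. c j \<in> carrier_mat n n"
  shows "mat_le n (mat_sum n (\<lambda>j. mat_adjoint (c j) * c j) UNIV) (1\<^sub>m n) \<longleftrightarrow>
    (\<forall>v\<in>carrier_vec n. (\<Sum>j\<in>UNIV. vnorm2 (c j *\<^sub>v v)) \<le> vnorm2 v)"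
proof -
  let ?M = "mat_sum n (\<lambda>j. mat_adjoint (c j) * c j) UNIV"
  have "((1\<^sub>m n - ?M) *\<^sub>v v) \<bullet>c v = complex_of_real (vnorm2 v - (\<Sum>j\<in>UNIV. vnorm2 (c j *\<^sub>v v)))"
    if v: "v \<in> carrier_vec n" for v
  proof -
    have Mv: "?M *\<^sub>v v \<in> carrier_vec n" using mat_sum_carrier by (rule mult_mat_vec_carrier[OF _ v])
    have "(1\<^sub>m n - ?M) *\<^sub>v v = v - ?M *\<^sub>v v"
      using v by (simp add: minus_mult_distrib_mat_vec[OF one_carrier_mat mat_sum_carrier v])
    then have "((1\<^sub>m n - ?M) *\<^sub>v v) \<bullet>c v = v \<bullet>c v - (?M *\<^sub>v v) \<bullet>c v"
      using v Mv by (simp add: minus_scalar_prod_distrib[of _ n])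
    also have "(?M *\<^sub>v v) \<bullet>c v = (\<Sum>j\<in>UNIV. ((mat_adjoint (c j) * c j) *\<^sub>v v) \<bullet>c v)"
      using c by (intro mat_sum_cscalar_prod v mult_carrier_mat mat_adjoint_carrier)
    also have "\<dots> = (\<Sum>j\<in>UNIV. complex_of_real (vnorm2 (c j *\<^sub>v v)))"
    proof (rule sum.cong[OF refl])
      fix j
      have "(mat_adjoint (c j) * c j) *\<^sub>v v = mat_adjoint (c j) *\<^sub>v (c j *\<^sub>v v)"
        by (rule assoc_mult_mat_vec[OF mat_adjoint_carrier[OF c] c v])
      then show "((mat_adjoint (c j) * c j) *\<^sub>v v) \<bullet>c v = complex_of_real (vnorm2 (c j *\<^sub>v v))"
        using mat_adjoint_cscalar_prod[OF c mult_mat_vec_carrier[OF c v] v]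
        by (simp add: cscalar_prod_self)
    qed
    finally show ?thesis by (simp add: cscalar_prod_self)
  qed
  then show ?thesis by (auto simp: mat_le_def less_eq_complex_def)
qed

section \<open>Limits of compressions as unital completely positive maps\<close>

definition limit_compression :: "nat filter \<Rightarrow> nat \<Rightarrow> (nat \<Rightarrow> nat \<Rightarrow> ell2) \<Rightarrow> opr \<Rightarrow> complex mat" where
  "limit_compression F n \<zeta> T = mat n n (\<lambda>(r, s). Lim F (\<lambda>m. cinner (T (\<zeta> s m)) (\<zeta> r m)))"

lemma limit_compression_carrier: "limit_compression F n \<zeta> T \<in> carrier_mat n n"
  by (simp add: limit_compression_def)

context
  fixes F n \<zeta>
  assumes F: "limit_filter F" and \<zeta>: "asymp_orthonormal F n \<zeta>"
begin

lemma F_nontrivial: "F \<noteq> bot"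
  using F by (simp add: limit_filter_def)

lemma limit_compression_entry:
  assumes T: "T \<in> \<bbbB>" and r: "r < n" and s: "s < n"
  shows "((\<lambda>m. cinner (T (\<zeta> s m)) (\<zeta> r m)) \<longlongrightarrow> limit_compression F n \<zeta> T $$ (r, s)) F"
proof -
  have w: "weakly_null (\<zeta> r)" "weakly_null (\<zeta> s)" using \<zeta> r s by (auto simp: asymp_orthonormal_def)
  obtain l where l: "((\<lambda>m. cinner (T (\<zeta> s m)) (\<zeta> r m)) \<longlongrightarrow> l) F"
    using limit_filter_cinner[OF F weakly_null_bounded[OF weakly_null_apply[OF w(2) T]] weakly_null_bounded[OF w(1)]]
    by blast
  then show ?thesis using r s tendsto_Lim[OF F_nontrivial l] by (simp add: limit_compression_def)
qed

lemma limit_compression_form: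
  assumes T: "T \<in> \<bbbB>" and v: "v \<in> carrier_vec n" and w: "w \<in> carrier_vec n"
  shows "((\<lambda>m. cinner (T (lincomb n (\<lambda>s. v $ s) \<zeta> m)) (lincomb n (\<lambda>r. w $ r) \<zeta> m)) \<longlongrightarrow>
    (limit_compression F n \<zeta> T *\<^sub>v v) \<bullet>c w) F"
proof -
  have "((\<lambda>m. \<Sum>r<n. cnj (w $ r) * (\<Sum>s<n. v $ s * cinner (T (\<zeta> s m)) (\<zeta> r m))) \<longlongrightarrow>
     (\<Sum>r<n. cnj (w $ r) * (\<Sum>s<n. v $ s * limit_compression F n \<zeta> T $$ (r, s)))) F"
    by (intro tendsto_sum tendsto_mult tendsto_const limit_compression_entry T) auto
  also have "(\<lambda>m. \<Sum>r<n. cnj (w $ r) * (\<Sum>s<n. v $ s * cinner (T (\<zeta> s m)) (\<zeta> r m))) =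
      (\<lambda>m. cinner (T (lincomb n (\<lambda>s. v $ s) \<zeta> m)) (lincomb n (\<lambda>r. w $ r) \<zeta> m))"
    by (simp add: lincomb_def blinfun.sum_right bounded_opsD[OF T] cinner_simps)
  also have "(\<Sum>r<n. cnj (w $ r) * (\<Sum>s<n. v $ s * limit_compression F n \<zeta> T $$ (r, s))) =
      (limit_compression F n \<zeta> T *\<^sub>v v) \<bullet>c w"
    unfolding cscalar_prod_sum[OF w]
    by (rule sum.cong) (auto simp: mult_mat_vec_index[OF limit_compression_carrier v] mult.commute)
  finally show ?thesis .
qed

lemma limit_compression_unique:
  assumes T: "T \<in> \<bbbB>" and M: "M \<in> carrier_mat n n"
    and lim: "\<And>r s. r < n \<Longrightarrow> s < n \<Longrightarrow> ((\<lambda>m. cinner (T (\<zeta> s m)) (\<zeta> r m)) \<longlongrightarrow> M $$ (r, s)) F"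
  shows "limit_compression F n \<zeta> T = M"
proof (rule eq_matI)
  fix r s assume "r < dim_row M" "s < dim_col M"
  then have "r < n" "s < n" using M by auto
  then show "limit_compression F n \<zeta> T $$ (r, s) = M $$ (r, s)"
    using tendsto_unique[OF F_nontrivial limit_compression_entry[OF T] lim] by blast
qed (use M in \<open>auto simp: limit_compression_def\<close>)

lemma limit_compression_compact:
  assumes K: "K \<in> \<bbbK>"
  shows "limit_compression F n \<zeta> K = 0\<^sub>m n n"
proof (rule limit_compression_unique)
  fix r s assume rs: "r < n" "s < n"
  then have w: "weakly_null (\<zeta> r)" "weakly_null (\<zeta> s)" using \<zeta> by (auto simp: asymp_orthonormal_def)
  have "((\<lambda>m. K (\<zeta> s m)) \<longlongrightarrow> 0) F"
    using F tendsto_mono[OF _ compact_ops_weakly_null[OF K w(2)]] by (simp add: limit_filter_def)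
  then show "((\<lambda>m. cinner (K (\<zeta> s m)) (\<zeta> r m)) \<longlongrightarrow> 0\<^sub>m n n $$ (r, s)) F"
    using rs by (simp add: tendsto_cinner_null weakly_null_bounded w)
qed (use K in \<open>auto simp: compact_ops_def\<close>)

text \<open>Before the limit, at stage \<open>k\<close>, stands the compression by the map sending
  the basis vector \<open>s\<close> to \<open>\<zeta> s k\<close>. Its form on an array
  \<open>a\<close> and vectors \<open>v i\<close> is the form of \<open>a\<close> at the
  combinations of the \<open>\<zeta> s k\<close> with coefficients \<open>v i\<close>, hence
  nonnegative; the limit is taken in real and imaginary part separately. Unitality is orthonormality
  in the limit.\<close>

lemma ucp_limit_compression:
  assumes A: "A \<subseteq> \<bbbB>"
  shows "ucp A n (limit_compression F n \<zeta>)"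
  unfolding ucp_def
proof (intro conjI ballI allI impI)
  show "limit_compression F n \<zeta> a \<in> carrier_mat n n" for a by (rule limit_compression_carrier)
  show "limit_compression F n \<zeta> (a + b) = limit_compression F n \<zeta> a + limit_compression F n \<zeta> b"
    if "a \<in> A" "b \<in> A" for a b
  proof (rule limit_compression_unique)
    have B: "a \<in> \<bbbB>" "b \<in> \<bbbB>" using A that by auto
    then show "a + b \<in> \<bbbB>" using cstar_subalgebra_bounded_ops by (simp add: cstar_subalgebra_def)
    fix r s assume "r < n" "s < n"
    with tendsto_add[OF limit_compression_entry[OF B(1)] limit_compression_entry[OF B(2)]]
    show "((\<lambda>m. cinner ((a + b) (\<zeta> s m)) (\<zeta> r m)) \<longlongrightarrow>
       (limit_compression F n \<zeta> a + limit_compression F n \<zeta> b) $$ (r, s)) F"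
      by (simp add: blinfun.add_left cinner_simps limit_compression_def)
  qed (simp add: limit_compression_def)
  show "limit_compression F n \<zeta> (c *\<^sub>O a) = c \<cdot>\<^sub>m limit_compression F n \<zeta> a" if "a \<in> A" for c a
  proof (rule limit_compression_unique)
    have B: "a \<in> \<bbbB>" using A that by auto
    then show "c *\<^sub>O a \<in> \<bbbB>" using cstar_subalgebra_bounded_ops by (simp add: cstar_subalgebra_def)
    fix r s assume "r < n" "s < n"
    with tendsto_mult_left[OF limit_compression_entry[OF B]]
    show "((\<lambda>m. cinner ((c *\<^sub>O a) (\<zeta> s m)) (\<zeta> r m)) \<longlongrightarrow> (c \<cdot>\<^sub>m limit_compression F n \<zeta> a) $$ (r, s)) F"
      by (simp add: cinner_simps limit_compression_def)
  qed (simp add: limit_compression_def)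
  show "limit_compression F n \<zeta> id_blinfun = 1\<^sub>m n"
  proof (rule limit_compression_unique)
    show "id_blinfun \<in> \<bbbB>" by (simp add: bounded_ops_def)
    fix r s assume rs: "r < n" "s < n"
    then show "((\<lambda>m. cinner (id_blinfun (\<zeta> s m)) (\<zeta> r m)) \<longlongrightarrow> 1\<^sub>m n $$ (r, s)) F"
      using \<zeta> unfolding asymp_orthonormal_def by (cases "r = s") fastforce+
  qed simp
  fix m and a :: "nat \<Rightarrow> nat \<Rightarrow> opr"
  assume a: "(\<forall>i<m. \<forall>j<m. a i j \<in> A) \<and> op_matrix_pos m a"
  show "block_matrix_pos m n (\<lambda>i j. limit_compression F n \<zeta> (a i j))"
    unfolding block_matrix_pos_def
  proof (intro allI impI)
    fix v :: "nat \<Rightarrow> complex vec" assume v: "\<forall>i<m. v i \<in> carrier_vec n"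
    let ?L = "\<Sum>i<m. \<Sum>j<m. (limit_compression F n \<zeta> (a i j) *\<^sub>v v j) \<bullet>c v i"
    define f where "f k = (\<Sum>i<m. \<Sum>j<m. cinner (a i j (lincomb n (\<lambda>s. v j $ s) \<zeta> k))
      (lincomb n (\<lambda>s. v i $ s) \<zeta> k))" for k
    have f: "(f \<longlongrightarrow> ?L) F"
      unfolding f_def[abs_def] using a A v
      by (intro tendsto_sum limit_compression_form) auto
    have pos: "0 \<le> f k" for k
    proof -
      have "\<forall>h. 0 \<le> (\<Sum>i<m. \<Sum>j<m. cinner (blinfun_apply (a i j) (h j)) (h i))"
        using a by (simp add: op_matrix_pos_def)
      from this[rule_format, of "\<lambda>i. lincomb n (\<lambda>s. v i $ s) \<zeta> k"] show ?thesis by (simp add: f_def)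
    qed
    have "0 \<le> Re ?L"
      by (rule tendsto_lowerbound[OF tendsto_Re[OF f] _ F_nontrivial])
        (use pos in \<open>auto simp: less_eq_complex_def\<close>)
    moreover have "Im ?L = 0"
    proof (rule tendsto_unique[OF F_nontrivial tendsto_Im[OF f]])
      have "Im (f k) = 0" for k using pos[of k] by (simp add: less_eq_complex_def)
      then show "((\<lambda>k. Im (f k)) \<longlongrightarrow> 0) F" by simp
    qed
    ultimately show "0 \<le> ?L" by (simp add: less_eq_complex_def)
  qed
qed

end

text \<open>The first unit vector stands for the normalized \<open>\<xi>\<close>. With all
  \<open>x j (\<zeta> 0 m)\<close> asymptotically in the span, the compression preserves the limits
  of their norms, so the excess \<open>\<delta>\<close> on the sequence shows up at a single
  vector.\<close>

lemma column_norm_violation: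
  fixes x :: "'d::finite \<Rightarrow> opr"
  assumes x: "\<And>j. x j \<in> \<bbbB>" and A: "A \<subseteq> \<bbbB>" and \<xi>: "weakly_null \<xi>" and \<delta>: "0 < \<delta>"
    and le: "\<And>m. (norm (\<xi> m))\<^sup>2 + \<delta> \<le> (\<Sum>j\<in>UNIV. (norm (x j (\<xi> m)))\<^sup>2)"
  shows "\<exists>n \<phi> v. 1 \<le> n \<and> ucp A n \<phi> \<and> (\<forall>a\<in>\<bbbK>. \<phi> a = 0\<^sub>m n n) \<and> v \<in> carrier_vec n \<and>
    vnorm2 v < (\<Sum>j\<in>UNIV. vnorm2 (\<phi> (x j) *\<^sub>v v))"
proof -
  obtain F where F: "limit_filter F" using limit_filter_exists by blast
  have nF: "F \<noteq> bot" using F by (simp add: limit_filter_def)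
  obtain l where l: "((\<lambda>m. cinner (\<xi> m) (\<xi> m)) \<longlongrightarrow> l) F"
    using limit_filter_cinner[OF F weakly_null_bounded[OF \<xi>] weakly_null_bounded[OF \<xi>]] by blast
  define L where "L = Re l"
  have L: "((\<lambda>m. (norm (\<xi> m))\<^sup>2) \<longlongrightarrow> L) F"
    using tendsto_Re[OF l] by (simp add: cinner_self L_def)
  \<comment> \<open>\<open>C\<close> serves to exclude \<open>L = 0\<close>: the bound
    \<open>\<delta> \<le> C \<parallel>\<xi> m\<parallel>\<^sup>2\<close> keeps \<open>\<xi>\<close>
    away from 0, so that it can be normalized in the limit.\<close>
  define C where "C = (\<Sum>j\<in>UNIV. (norm (x j))\<^sup>2)"
  have "\<delta> \<le> C * (norm (\<xi> m))\<^sup>2" for m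
  proof -
    have "(norm (x j (\<xi> m)))\<^sup>2 \<le> (norm (x j))\<^sup>2 * (norm (\<xi> m))\<^sup>2" for j
      unfolding power_mult_distrib[symmetric] by (intro power_mono norm_blinfun) simp
    then have "(\<Sum>j\<in>UNIV. (norm (x j (\<xi> m)))\<^sup>2) \<le> C * (norm (\<xi> m))\<^sup>2"
      unfolding C_def sum_distrib_right by (rule sum_mono)
    then show ?thesis using le[of m] zero_le_power2[of "norm (\<xi> m)"] by linarith
  qed
  then have "\<delta> \<le> C * L"
    by (intro tendsto_lowerbound[OF tendsto_mult_left[OF L] _ nF]) simp
  moreover have "0 \<le> L" by (intro tendsto_lowerbound[OF L _ nF]) simp
  ultimately have L0: "0 < L" using \<delta> by (cases "L = 0") auto
  define a where "a = complex_of_real (1 / sqrt L)"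
  have aa: "(cmod a)\<^sup>2 = 1 / L" using L0 by (simp add: a_def norm_divide power_divide)
  define \<zeta>0 where "\<zeta>0 = (\<lambda>(_::nat) m. a *\<^sub>C \<xi> m)"
  have \<zeta>0: "asymp_orthonormal F 1 \<zeta>0"
  proof -
    have "((\<lambda>m. complex_of_real ((cmod a)\<^sup>2 * (norm (\<xi> m))\<^sup>2)) \<longlongrightarrow> complex_of_real ((1 / L) * L)) F"
      unfolding aa by (intro tendsto_of_real tendsto_mult_left L)
    then have "((\<lambda>m. cinner (\<zeta>0 0 m) (\<zeta>0 0 m)) \<longlongrightarrow> 1) F"
      using L0 by (simp add: cinner_self \<zeta>0_def norm_scaleC power_mult_distrib)
    then show ?thesis using weakly_null_scaleC[OF \<xi>, of a] by (simp add: asymp_orthonormal_def \<zeta>0_def)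
  qed
  obtain e :: "nat \<Rightarrow> 'd" where e: "bij_betw e {..<CARD('d)} UNIV"
    using ex_bij_betw_nat_finite[of "UNIV :: 'd set"] by (auto simp: lessThan_atLeast0)
  have "weakly_null (\<lambda>m. x (e i) (\<zeta>0 0 m))" for i
    by (intro weakly_null_apply x) (use \<zeta>0 in \<open>simp add: asymp_orthonormal_def\<close>)
  then obtain n \<zeta> where n: "1 \<le> n" and \<zeta>: "asymp_orthonormal F n \<zeta>" and eq: "\<zeta> 0 = \<zeta>0 0"
    and sp: "\<And>i. i < CARD('d) \<Longrightarrow> asymp_span F n \<zeta> (\<lambda>m. x (e i) (\<zeta>0 0 m))"
    using asymp_Gram_Schmidt[OF F \<zeta>0, of "CARD('d)" "\<lambda>i m. x (e i) (\<zeta>0 0 m)"] by auto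
  define \<phi> where "\<phi> = limit_compression F n \<zeta>"
  define v :: "complex vec" where "v = unit_vec n 0"
  have v: "v \<in> carrier_vec n" by (simp add: v_def)
  have v1: "vnorm2 v = 1"
  proof -
    have "vnorm2 v = (\<Sum>r<n. if r = 0 then 1 else 0)"
      unfolding vnorm2_def by (intro sum.cong) (auto simp: v_def)
    then show ?thesis using n by simp
  qed
  have lim: "((\<lambda>m. (norm (x j (\<zeta> 0 m)))\<^sup>2) \<longlongrightarrow> vnorm2 (\<phi> (x j) *\<^sub>v v)) F" for j
  proof -
    obtain i where "i < CARD('d)" "j = e i" using e by (auto simp: bij_betw_def)
    then have "asymp_span F n \<zeta> (\<lambda>m. x j (\<zeta> 0 m))" using sp by (simp add: eq)
    then obtain c where c: "((\<lambda>m. x j (\<zeta> 0 m) - lincomb n c \<zeta> m) \<longlongrightarrow> 0) F"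
      unfolding asymp_span_def by blast
    have w0: "weakly_null (\<zeta> 0)" using \<zeta> n by (simp add: asymp_orthonormal_def)
    have n1: "((\<lambda>m. (norm (x j (\<zeta> 0 m)))\<^sup>2) \<longlongrightarrow> (\<Sum>r<n. (cmod (c r))\<^sup>2)) F"
      by (rule asymp_norm[OF \<zeta> c weakly_null_bounded[OF weakly_null_apply[OF w0 x]]])
    have "(\<phi> (x j) *\<^sub>v v) $ r = c r" if r: "r < n" for r
    proof -
      have "(\<phi> (x j) *\<^sub>v v) $ r = (\<Sum>s<n. if s = 0 then \<phi> (x j) $$ (r, s) else 0)"
        unfolding \<phi>_def mult_mat_vec_index[OF limit_compression_carrier v r]
        by (intro sum.cong) (auto simp: v_def)
      also have "\<dots> = \<phi> (x j) $$ (r, 0)" using n by simp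
      also have "\<dots> = c r"
        unfolding \<phi>_def using n
        by (intro tendsto_unique[OF nF limit_compression_entry[OF F \<zeta> x r] asymp_coefficient[OF \<zeta> c r]]) simp
      finally show ?thesis .
    qed
    then have "vnorm2 (\<phi> (x j) *\<^sub>v v) = (\<Sum>r<n. (cmod (c r))\<^sup>2)"
      by (simp add: vnorm2_def \<phi>_def limit_compression_def)
    then show ?thesis using n1 by simp
  qed
  \<comment> \<open>Normalization multiplies squared norms by \<open>1 / L\<close>, and the excess
    \<open>\<delta>\<close> with them.\<close>
  have "1 + \<delta> / L \<le> (\<Sum>j\<in>UNIV. vnorm2 (\<phi> (x j) *\<^sub>v v))"
  proof (rule tendsto_le[OF nF tendsto_sum[OF lim]])
    have "((\<lambda>m. (1 / L) * ((norm (\<xi> m))\<^sup>2 + \<delta>)) \<longlongrightarrow> (1 / L) * (L + \<delta>)) F"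
      by (intro tendsto_intros L)
    then show "((\<lambda>m. (1 / L) * ((norm (\<xi> m))\<^sup>2 + \<delta>)) \<longlongrightarrow> 1 + \<delta> / L) F"
      using L0 by (simp add: field_simps)
    have "(1 / L) * ((norm (\<xi> m))\<^sup>2 + \<delta>) \<le> (\<Sum>j\<in>UNIV. (norm (x j (\<zeta> 0 m)))\<^sup>2)" for m
    proof -
      have "(\<Sum>j\<in>UNIV. (norm (x j (\<zeta> 0 m)))\<^sup>2) = (1 / L) * (\<Sum>j\<in>UNIV. (norm (x j (\<xi> m)))\<^sup>2)"
        by (simp add: eq \<zeta>0_def bounded_opsD[OF x] norm_scaleC power_mult_distrib aa sum_distrib_left)
      then show ?thesis using mult_left_mono[OF le[of m], of "1 / L"] L0 by simp
    qed
    then show "\<forall>\<^sub>F m in F. (1 / L) * ((norm (\<xi> m))\<^sup>2 + \<delta>) \<le> (\<Sum>j\<in>UNIV. (norm (x j (\<zeta> 0 m)))\<^sup>2)"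
      by simp
  qed
  moreover have "0 < \<delta> / L" using \<delta> L0 by simp
  ultimately have "vnorm2 v < (\<Sum>j\<in>UNIV. vnorm2 (\<phi> (x j) *\<^sub>v v))" using v1 by linarith
  then show ?thesis
    using n v ucp_limit_compression[OF F \<zeta> A] limit_compression_compact[OF F \<zeta>]
    unfolding \<phi>_def by blast
qed

section \<open>The OH ball\<close>

lemma OH_Ball_iff:
  "(n, c) \<in> OH_Ball \<longleftrightarrow> 1 \<le> n \<and> (\<forall>j. c j \<in> carrier_mat n n) \<and>
    (\<forall>v\<in>carrier_vec n. (\<Sum>j\<in>UNIV. vnorm2 (c j *\<^sub>v v)) \<le> vnorm2 v)"
  unfolding OH_Ball_def using mat_le_one_iff[of c n] by auto

section \<open>Compactness and matrix convexity of the ball\<close>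

lemma vnorm2_mult_mat_vec:
  assumes "A \<in> carrier_mat m n" "v \<in> carrier_vec n"
  shows "vnorm2 (A *\<^sub>v v) = (\<Sum>r<m. (cmod (\<Sum>s<n. A $$ (r, s) * v $ s))\<^sup>2)"
proof -
  have "dim_vec (A *\<^sub>v v) = m" using assms by simp
  then show ?thesis
    unfolding vnorm2_def by (intro sum.cong) (simp_all only: mult_mat_vec_index[OF assms] lessThan_iff)
qed

lemma Re_cscalar_prod_le:
  assumes "u \<in> carrier_vec n" "w \<in> carrier_vec n"
  shows "2 * Re (u \<bullet>c w) \<le> vnorm2 u + vnorm2 w"
proof -
  have "2 * Re (a * cnj b) \<le> (cmod a)\<^sup>2 + (cmod b)\<^sup>2" for a b
  proof -
    have "0 \<le> (Re a - Re b)\<^sup>2 + (Im a - Im b)\<^sup>2" by simp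
    then show ?thesis unfolding cmod_power2 by (simp add: power2_eq_square algebra_simps)
  qed
  then have "(\<Sum>r<n. 2 * Re (u $ r * cnj (w $ r))) \<le> (\<Sum>r<n. (cmod (u $ r))\<^sup>2 + (cmod (w $ r))\<^sup>2)"
    by (intro sum_mono)
  then show ?thesis
    using assms by (simp add: cscalar_prod_sum[OF assms(2)] vnorm2_def sum.distrib sum_distrib_left)
qed

text \<open>Testing on unit vectors bounds all entries by 1, so the level sits in the product of
  discs \<open>K\<close>. There it is cut out by closed conditions: \<open>Z\<close> for the zeros
  outside the block, and \<open>Q\<close>, one inequality per vector, for the ball.\<close>

lemma compact_OH_Ball_level:
  assumes n: "1 \<le> n"
  shows "compact (mat_entries n ` level (OH_Ball :: 'd::finite graded) n)"
proof -
  define K :: "('d \<Rightarrow> nat \<Rightarrow> nat \<Rightarrow> complex) set"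
    where "K = PiE UNIV (\<lambda>j. PiE UNIV (\<lambda>r. PiE UNIV (\<lambda>s. cball 0 1)))"
  \<comment> \<open>The value 0 inside the block makes the condition void there, so \<open>Z\<close>
    constrains only the other coordinates.\<close>
  define Z :: "('d \<Rightarrow> nat \<Rightarrow> nat \<Rightarrow> complex) set"
    where "Z = {f. \<forall>j r s. (if r < n \<and> s < n then 0 else f j r s) = 0}"
  define Q :: "('d \<Rightarrow> nat \<Rightarrow> nat \<Rightarrow> complex) set"
    where "Q = (\<Inter>v\<in>carrier_vec n.
      {f. (\<Sum>j\<in>UNIV. \<Sum>r<n. (cmod (\<Sum>s<n. f j r s * v $ s))\<^sup>2) \<le> vnorm2 v})"
  have co: "continuous_on UNIV (\<lambda>f :: 'd \<Rightarrow> nat \<Rightarrow> nat \<Rightarrow> complex. f j r s)" for j r s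
    by (rule continuous_on_product_then_coordinatewise[OF
        continuous_on_product_then_coordinatewise[OF continuous_on_product_coordinates]])
  have "compact K" unfolding K_def by (intro compact_PiE_UNIV compact_cball)
  moreover have "closed Z"
  proof -
    have "closed {f :: 'd \<Rightarrow> nat \<Rightarrow> nat \<Rightarrow> complex. (if r < n \<and> s < n then 0 else f j r s) = 0}" for j r s
      by (cases "r < n \<and> s < n") (simp_all add: closed_Collect_eq[OF co continuous_on_const])
    then show ?thesis unfolding Z_def by (intro closed_Collect_all)
  qed
  moreover have "closed Q"
    unfolding Q_def by (intro closed_INT ballI closed_Collect_le continuous_on_sum continuous_on_power
      continuous_on_norm continuous_on_mult_right continuous_on_const co)
  ultimately have "compact (K \<inter> (Z \<inter> Q))" by (intro compact_Int_closed closed_Int)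
  also have "K \<inter> (Z \<inter> Q) = mat_entries n ` level OH_Ball n"
  proof (intro equalityI subsetI)
    fix f assume f: "f \<in> K \<inter> (Z \<inter> Q)"
    define a where "a j = mat n n (\<lambda>(r, s). f j r s)" for j
    have a: "a j \<in> carrier_mat n n" for j by (simp add: a_def)
    have "f = mat_entries n a"
    proof (intro ext)
      fix j r s
      have "(if r < n \<and> s < n then 0 else f j r s) = 0" using f unfolding Z_def by blast
      then show "f j r s = mat_entries n a j r s"
        by (auto simp: mat_entries_def a_def split: if_splits)
    qed
    moreover have "(\<Sum>j\<in>UNIV. vnorm2 (a j *\<^sub>v v)) \<le> vnorm2 v" if v: "v \<in> carrier_vec n" for v
    proof -
      have "(\<Sum>j\<in>UNIV. vnorm2 (a j *\<^sub>v v)) = (\<Sum>j\<in>UNIV. \<Sum>r<n. (cmod (\<Sum>s<n. f j r s * v $ s))\<^sup>2)"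
        unfolding vnorm2_mult_mat_vec[OF a v] by (simp add: a_def)
      then show ?thesis using f v unfolding Q_def by simp
    qed
    ultimately show "f \<in> mat_entries n ` level OH_Ball n"
      using a n by (auto simp: level_def OH_Ball_iff)
  next
    fix f assume "f \<in> mat_entries n ` level (OH_Ball :: 'd graded) n"
    then obtain a :: "'d \<Rightarrow> complex mat" where fa: "f = mat_entries n a" and a: "\<And>j. a j \<in> carrier_mat n n"
      and le: "\<And>v. v \<in> carrier_vec n \<Longrightarrow> (\<Sum>j\<in>UNIV. vnorm2 (a j *\<^sub>v v)) \<le> vnorm2 v"
      by (auto simp: level_def OH_Ball_iff)
    have "cmod (a j $$ (r, s)) \<le> 1" if rs: "r < n" "s < n" for j r s
    proof -
      define v :: "complex vec" where "v = unit_vec n s"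
      have v: "v \<in> carrier_vec n" by (simp add: v_def)
      have "(\<Sum>t<n. a j $$ (r, t) * v $ t) = (\<Sum>t<n. if t = s then a j $$ (r, t) else 0)"
        by (intro sum.cong) (auto simp: v_def rs)
      then have "(cmod (a j $$ (r, s)))\<^sup>2 = (cmod (\<Sum>t<n. a j $$ (r, t) * v $ t))\<^sup>2"
        using rs by simp
      also have "\<dots> \<le> (\<Sum>r<n. (cmod (\<Sum>t<n. a j $$ (r, t) * v $ t))\<^sup>2)"
        using rs by (intro member_le_sum) auto
      also have "\<dots> = vnorm2 (a j *\<^sub>v v)" by (simp add: vnorm2_mult_mat_vec[OF a v])
      also have "\<dots> \<le> (\<Sum>j\<in>UNIV. vnorm2 (a j *\<^sub>v v))"
        by (intro member_le_sum) (auto simp: vnorm2_def sum_nonneg)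
      also have "\<dots> \<le> vnorm2 v" by (rule le[OF v])
      also have "\<dots> = (\<Sum>r<n. if r = s then 1 else 0)"
        unfolding vnorm2_def by (intro sum.cong) (auto simp: v_def rs)
      also have "\<dots> = 1" using rs by simp
      finally show ?thesis using power2_le_imp_le[of "cmod (a j $$ (r, s))" 1] by simp
    qed
    then have "f \<in> K" by (auto simp: K_def fa mat_entries_def)
    moreover have "f \<in> Z" by (simp add: Z_def fa mat_entries_def)
    moreover have "f \<in> Q"
    proof -
      have "(\<Sum>j\<in>UNIV. \<Sum>r<n. (cmod (\<Sum>s<n. f j r s * v $ s))\<^sup>2) \<le> vnorm2 v"
        if v: "v \<in> carrier_vec n" for v
        using le[OF v] by (simp add: vnorm2_mult_mat_vec[OF a v] fa mat_entries_def)
      then show ?thesis by (simp add: Q_def)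
    qed
    ultimately show "f \<in> K \<inter> (Z \<inter> Q)" by blast
  qed
  finally show ?thesis .
qed

text \<open>Stacked on top of each other, the \<open>\<gamma> i\<close> form an isometry: evaluate
  the quadratic form of the given identity at \<open>w\<close>.\<close>

lemma vnorm2_isometry:
  fixes \<gamma> :: "nat \<Rightarrow> complex mat"
  assumes \<gamma>: "\<And>i. i < m \<Longrightarrow> \<gamma> i \<in> carrier_mat (N i) n"
    and one: "mat_sum n (\<lambda>i. mat_adjoint (\<gamma> i) * \<gamma> i) {..<m} = 1\<^sub>m n"
    and w: "w \<in> carrier_vec n"
  shows "(\<Sum>i<m. vnorm2 (\<gamma> i *\<^sub>v w)) = vnorm2 w"
proof -
  have "w \<bullet>c w = (mat_sum n (\<lambda>i. mat_adjoint (\<gamma> i) * \<gamma> i) {..<m} *\<^sub>v w) \<bullet>c w"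
    using w by (simp add: one)
  also have "\<dots> = (\<Sum>i<m. ((mat_adjoint (\<gamma> i) * \<gamma> i) *\<^sub>v w) \<bullet>c w)"
    using \<gamma> by (intro mat_sum_cscalar_prod w mult_carrier_mat mat_adjoint_carrier) auto
  also have "\<dots> = (\<Sum>i<m. complex_of_real (vnorm2 (\<gamma> i *\<^sub>v w)))"
  proof (rule sum.cong[OF refl])
    fix i assume "i \<in> {..<m}"
    then have g: "\<gamma> i \<in> carrier_mat (N i) n" using \<gamma> by simp
    show "((mat_adjoint (\<gamma> i) * \<gamma> i) *\<^sub>v w) \<bullet>c w = complex_of_real (vnorm2 (\<gamma> i *\<^sub>v w))"
      unfolding assoc_mult_mat_vec[OF mat_adjoint_carrier[OF g] g w]
        mat_adjoint_cscalar_prod[OF g mult_mat_vec_carrier[OF g w] w] by (rule cscalar_prod_self)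
  qed
  finally have "complex_of_real (\<Sum>i<m. vnorm2 (\<gamma> i *\<^sub>v w)) = complex_of_real (vnorm2 w)"
    by (simp add: cscalar_prod_self)
  then show ?thesis by (simp only: of_real_eq_iff)
qed

text \<open>For one \<open>j\<close>, let \<open>w\<close> be the image of \<open>v\<close> under
  the combined matrix. Its squared norm is the sum over \<open>i\<close> of the inner products of
  \<open>a i j \<gamma> i v\<close> with \<open>\<gamma> i w\<close>. As the
  \<open>\<gamma> i\<close> together preserve norms, this bounds \<open>vnorm2 w\<close> by the sum
  of the \<open>vnorm2\<close> of the vectors \<open>a i j \<gamma> i v\<close>. Summing over
  \<open>j\<close> brings in the ball condition for each \<open>a i\<close>.\<close>

lemma compact_matrix_convex_OH_Ball: "compact_matrix_convex (OH_Ball :: 'd::finite graded)"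
  unfolding compact_matrix_convex_def
proof (intro conjI allI impI)
  show "\<forall>(n, a)\<in>(OH_Ball :: 'd graded). 1 \<le> n \<and> (\<forall>j. a j \<in> carrier_mat n n)"
    by (auto simp: OH_Ball_iff)
  show "compact (mat_entries n ` level (OH_Ball :: 'd graded) n)" if "1 \<le> n" for n
    using that by (rule compact_OH_Ball_level)
  fix n m :: nat and N :: "nat \<Rightarrow> nat" and a :: "nat \<Rightarrow> 'd \<Rightarrow> complex mat" and \<gamma>
  assume n: "1 \<le> n" and asm: "(\<forall>i<m. a i \<in> level OH_Ball (N i) \<and> \<gamma> i \<in> carrier_mat (N i) n) \<and>
    mat_sum n (\<lambda>i. mat_adjoint (\<gamma> i) * \<gamma> i) {..<m} = 1\<^sub>m n"
  have \<gamma>: "\<gamma> i \<in> carrier_mat (N i) n" if "i < m" for i using asm that by blast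
  have a: "a i j \<in> carrier_mat (N i) (N i)" if "i < m" for i j
    using asm that by (auto simp: level_def OH_Ball_iff)
  have le: "(\<Sum>j\<in>UNIV. vnorm2 (a i j *\<^sub>v v)) \<le> vnorm2 v" if "i < m" "v \<in> carrier_vec (N i)" for i v
    using asm that by (auto simp: level_def OH_Ball_iff)
  have prod_carrier: "mat_adjoint (\<gamma> i) * a i j * \<gamma> i \<in> carrier_mat n n" if "i < m" for i j
    by (rule mult_carrier_mat[OF mult_carrier_mat[OF mat_adjoint_carrier[OF \<gamma>[OF that]] a[OF that]] \<gamma>[OF that]])
  note iso = vnorm2_isometry[OF \<gamma> conjunct2[OF asm]]
  let ?b = "\<lambda>j. mat_sum n (\<lambda>i. mat_adjoint (\<gamma> i) * a i j * \<gamma> i) {..<m}"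
  have "(\<Sum>j\<in>UNIV. vnorm2 (?b j *\<^sub>v v)) \<le> vnorm2 v" if v: "v \<in> carrier_vec n" for v
  proof -
    have "vnorm2 (?b j *\<^sub>v v) \<le> (\<Sum>i<m. vnorm2 (a i j *\<^sub>v (\<gamma> i *\<^sub>v v)))" for j
    proof -
      define w where "w = ?b j *\<^sub>v v"
      have w: "w \<in> carrier_vec n" unfolding w_def by (rule mult_mat_vec_carrier[OF mat_sum_carrier v])
      have "w \<bullet>c w = (\<Sum>i<m. ((mat_adjoint (\<gamma> i) * a i j * \<gamma> i) *\<^sub>v v) \<bullet>c w)"
        by (subst (1) w_def, rule mat_sum_cscalar_prod[OF _ v w]) (simp add: prod_carrier)
      also have "\<dots> = (\<Sum>i<m. (a i j *\<^sub>v (\<gamma> i *\<^sub>v v)) \<bullet>c (\<gamma> i *\<^sub>v w))"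
      proof (rule sum.cong[OF refl])
        fix i assume "i \<in> {..<m}"
        then have g: "\<gamma> i \<in> carrier_mat (N i) n" and ai: "a i j \<in> carrier_mat (N i) (N i)"
          using \<gamma> a by auto
        note gv = mult_mat_vec_carrier[OF g v]
        have "(mat_adjoint (\<gamma> i) * a i j * \<gamma> i) *\<^sub>v v = mat_adjoint (\<gamma> i) *\<^sub>v (a i j *\<^sub>v (\<gamma> i *\<^sub>v v))"
          unfolding assoc_mult_mat_vec[OF mult_carrier_mat[OF mat_adjoint_carrier[OF g] ai] g v]
          by (rule assoc_mult_mat_vec[OF mat_adjoint_carrier[OF g] ai gv])
        then show "((mat_adjoint (\<gamma> i) * a i j * \<gamma> i) *\<^sub>v v) \<bullet>c w = (a i j *\<^sub>v (\<gamma> i *\<^sub>v v)) \<bullet>c (\<gamma> i *\<^sub>v w)"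
          using mat_adjoint_cscalar_prod[OF g mult_mat_vec_carrier[OF ai gv] w] by simp
      qed
      \<comment> \<open>The doubling leaves one \<open>vnorm2 w\<close> after the isometry identity
        has absorbed the other.\<close>
      finally have "2 * vnorm2 w = (\<Sum>i<m. 2 * Re ((a i j *\<^sub>v (\<gamma> i *\<^sub>v v)) \<bullet>c (\<gamma> i *\<^sub>v w)))"
        by (simp add: cscalar_prod_self complex_eq_iff sum_distrib_left)
      also have "\<dots> \<le> (\<Sum>i<m. vnorm2 (a i j *\<^sub>v (\<gamma> i *\<^sub>v v)) + vnorm2 (\<gamma> i *\<^sub>v w))"
      proof (rule sum_mono)
        fix i assume "i \<in> {..<m}"
        then have g: "\<gamma> i \<in> carrier_mat (N i) n" and ai: "a i j \<in> carrier_mat (N i) (N i)"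
          using \<gamma> a by auto
        show "2 * Re ((a i j *\<^sub>v (\<gamma> i *\<^sub>v v)) \<bullet>c (\<gamma> i *\<^sub>v w)) \<le>
            vnorm2 (a i j *\<^sub>v (\<gamma> i *\<^sub>v v)) + vnorm2 (\<gamma> i *\<^sub>v w)"
          by (rule Re_cscalar_prod_le[OF mult_mat_vec_carrier[OF ai mult_mat_vec_carrier[OF g v]]
            mult_mat_vec_carrier[OF g w]])
      qed
      also have "\<dots> = (\<Sum>i<m. vnorm2 (a i j *\<^sub>v (\<gamma> i *\<^sub>v v))) + vnorm2 w"
        using iso[OF _ w] by (simp add: sum.distrib)
      finally show ?thesis by (simp add: w_def)
    qed
    then have "(\<Sum>j\<in>UNIV. vnorm2 (?b j *\<^sub>v v)) \<le> (\<Sum>j\<in>UNIV. \<Sum>i<m. vnorm2 (a i j *\<^sub>v (\<gamma> i *\<^sub>v v)))"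
      by (rule sum_mono)
    also have "\<dots> = (\<Sum>i<m. \<Sum>j\<in>UNIV. vnorm2 (a i j *\<^sub>v (\<gamma> i *\<^sub>v v)))" by (rule sum.swap)
    also have "\<dots> \<le> (\<Sum>i<m. vnorm2 (\<gamma> i *\<^sub>v v))"
      using \<gamma> v by (intro sum_mono le) (auto intro!: mult_mat_vec_carrier)
    also have "\<dots> = vnorm2 v" by (rule iso[OF _ v])
    finally show ?thesis .
  qed
  then show "?b \<in> level OH_Ball n"
    using n mat_sum_carrier by (auto simp: level_def OH_Ball_iff)
qed

section \<open>Images of column contractions under unital completely positive maps\<close>

lemma sum_arrow_matrix:
  fixes g :: "nat \<Rightarrow> nat \<Rightarrow> 'a::comm_monoid_add"
  assumes "\<And>i j. i < d \<Longrightarrow> j < d \<Longrightarrow> i \<noteq> j \<Longrightarrow> g i j = 0"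
  shows "(\<Sum>i<Suc d. \<Sum>j<Suc d. g i j) = (\<Sum>i<d. g i i + g i d + g d i) + g d d"
proof -
  have "(\<Sum>j<d. g i j) = g i i" if "i < d" for i
  proof -
    have "(\<Sum>j<d. g i j) = (\<Sum>j<d. if j = i then g i j else 0)"
      by (rule sum.cong) (use assms that in auto)
    then show ?thesis using that by simp
  qed
  then show ?thesis by (simp add: sum.distrib add_ac)
qed

text \<open>The arrow matrix \<open>a\<close> below has the columns \<open>y\<^sub>j\<close> and identities on the diagonal, so it is
  positive exactly when \<open>\<Sum>\<^sub>j y\<^sub>j\<^sup>* y\<^sub>j \<le> 1\<close>. Its image under \<open>\<phi>\<close> is tested on the vectors
  \<open>(z \<phi>(y\<^sub>j) u)\<^sub>j, u\<close> with \<open>z = 1, \<i>, -1\<close>; the first two make up for not knowing \<open>\<phi>(y\<^sub>j\<^sup>*) = \<phi>(y\<^sub>j)\<^sup>*\<close>.\<close>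

lemma ucp_column_contraction:
  fixes y :: "'d::finite \<Rightarrow> opr"
  assumes \<phi>: "ucp A n \<phi>" and A: "cstar_subalgebra A" and y: "\<And>j. y j \<in> A"
    and contr: "\<And>h. (\<Sum>j\<in>UNIV. (norm (y j h))\<^sup>2) \<le> (norm h)\<^sup>2"
    and u: "u \<in> carrier_vec n"
  shows "(\<Sum>j\<in>UNIV. vnorm2 (\<phi> (y j) *\<^sub>v u)) \<le> vnorm2 u"
proof -
  have AB: "A \<subseteq> \<bbbB>" and idA: "id_blinfun \<in> A" and adjA: "\<And>T. T \<in> A \<Longrightarrow> adj T \<in> A"
    using A by (auto simp: cstar_subalgebra_def)
  have yB: "y j \<in> \<bbbB>" for j using y AB by blast
  have zero: "(0 :: opr) = 0 *\<^sub>O id_blinfun" by (rule blinfun_eqI) (simp add: scaleC_simps)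
  have zeroA: "0 \<in> A" using A idA unfolding cstar_subalgebra_def by (subst zero) blast
  have car: "T \<in> A \<Longrightarrow> \<phi> T \<in> carrier_mat n n" for T using \<phi> by (simp add: ucp_def)
  have \<phi>1: "\<phi> id_blinfun = 1\<^sub>m n" using \<phi> by (simp add: ucp_def)
  have \<phi>0: "\<phi> 0 = 0\<^sub>m n n"
  proof -
    have "\<phi> (0 *\<^sub>O id_blinfun) = 0 \<cdot>\<^sub>m \<phi> id_blinfun" using \<phi> idA unfolding ucp_def by blast
    then show ?thesis by (simp add: zero[symmetric] \<phi>1) (auto intro!: eq_matI)
  qed
  define d where "d = CARD('d)"
  obtain e :: "nat \<Rightarrow> 'd" where e: "bij_betw e {..<d} UNIV"
    using ex_bij_betw_nat_finite[of "UNIV :: 'd set"] by (auto simp: lessThan_atLeast0 d_def)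
  define a where "a i j = (if i = d then if j = d then id_blinfun else adj (y (e j))
    else if j = d then y (e i) else if i = j then id_blinfun else 0)" for i j
  have aA: "a i j \<in> A" for i j by (simp add: a_def idA zeroA y adjA)
  have "op_matrix_pos (Suc d) a"
    unfolding op_matrix_pos_def
  proof (intro allI)
    fix h :: "nat \<Rightarrow> ell2"
    let ?k = "h d"
    have "(\<Sum>i<Suc d. \<Sum>j<Suc d. cinner (a i j (h j)) (h i)) =
      (\<Sum>i<d. cinner (h i) (h i) + cinner (y (e i) ?k) (h i) + cinner (adj (y (e i)) (h i)) ?k) + cinner ?k ?k"
      by (subst sum_arrow_matrix) (auto simp: a_def cinner_zero intro!: sum.cong)
    \<comment> \<open>Completing the square isolates the only negative term, which
      \<open>contr\<close> bounds by the form of the corner entry.\<close>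
    also have "\<dots> = (\<Sum>i<d. cinner (h i + y (e i) ?k) (h i + y (e i) ?k))
        - (\<Sum>i<d. cinner (y (e i) ?k) (y (e i) ?k)) + cinner ?k ?k"
      by (simp add: adj_props(2)[OF yB] cinner_simps sum_subtractf[symmetric] algebra_simps)
    also have "(\<Sum>i<d. cinner (y (e i) ?k) (y (e i) ?k)) = (\<Sum>j\<in>UNIV. cinner (y j ?k) (y j ?k))"
      by (rule sum.reindex_bij_betw[OF e])
    also have "(\<Sum>i<d. cinner (h i + y (e i) ?k) (h i + y (e i) ?k)) - \<dots> + cinner ?k ?k =
      complex_of_real ((\<Sum>i<d. (norm (h i + y (e i) ?k))\<^sup>2) - (\<Sum>j\<in>UNIV. (norm (y j ?k))\<^sup>2) + (norm ?k)\<^sup>2)"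
      by (simp add: cinner_self)
    also have "0 \<le> \<dots>"
    proof -
      have "0 \<le> (\<Sum>i<d. (norm (h i + y (e i) ?k))\<^sup>2)" by (intro sum_nonneg) simp
      then show ?thesis using contr[of ?k] by (simp add: less_eq_complex_def)
    qed
    finally show "0 \<le> (\<Sum>i<Suc d. \<Sum>j<Suc d. cinner (a i j (h j)) (h i))" .
  qed
  then have pos: "block_matrix_pos (Suc d) n (\<lambda>i j. \<phi> (a i j))"
    using \<phi> aA unfolding ucp_def by blast
  define W where "W i = \<phi> (y (e i)) *\<^sub>v u" for i
  have W: "W i \<in> carrier_vec n" for i unfolding W_def by (rule mult_mat_vec_carrier[OF car[OF y] u])
  define S where "S = (\<Sum>i<d. vnorm2 (W i))"
  define T where "T = (\<Sum>i<d. (\<phi> (adj (y (e i))) *\<^sub>v W i) \<bullet>c u)"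
  have test: "0 \<le> z * cnj z * S + cnj z * S + z * T + vnorm2 u" for z :: complex
  proof -
    define v where "v i = (if i = d then u else z \<cdot>\<^sub>v W i)" for i
    have v: "v i \<in> carrier_vec n" for i using u W by (simp add: v_def)
    have sc: "conjugate (z \<cdot>\<^sub>v W i) = cnj z \<cdot>\<^sub>v conjugate (W i)" for i
      by (rule eq_vecI) auto
    have cW: "conjugate (W i) \<in> carrier_vec n" for i using W by simp
    have "0 \<le> (\<Sum>i<Suc d. \<Sum>j<Suc d. (\<phi> (a i j) *\<^sub>v v j) \<bullet>c v i)"
      using pos v unfolding block_matrix_pos_def by blast
    also have "\<dots> = (\<Sum>i<d. (\<phi> (a i i) *\<^sub>v v i) \<bullet>c v i + (\<phi> (a i d) *\<^sub>v v d) \<bullet>c v i + (\<phi> (a d i) *\<^sub>v v i) \<bullet>c v d)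
        + (\<phi> (a d d) *\<^sub>v v d) \<bullet>c v d"
    proof (rule sum_arrow_matrix)
      fix i j assume "i < d" "j < d" "i \<noteq> j"
      then have "\<phi> (a i j) *\<^sub>v v j = 0\<^sub>v n"
        using v[of j] by (intro eq_vecI) (auto simp: a_def \<phi>0)
      then show "(\<phi> (a i j) *\<^sub>v v j) \<bullet>c v i = 0" using v[of i] by simp
    qed
    also have "\<dots> = (\<Sum>i<d. z * cnj z * (W i \<bullet>c W i) + cnj z * (W i \<bullet>c W i)
        + z * ((\<phi> (adj (y (e i))) *\<^sub>v W i) \<bullet>c u)) + u \<bullet>c u"
    proof (intro arg_cong2[of _ _ _ _ "(+)"] sum.cong refl)
      fix i assume "i \<in> {..<d}"
      then have i: "i < d" by simp
      then have vi: "v i = z \<cdot>\<^sub>v W i" and vd: "v d = u" by (auto simp: v_def)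
      have zW: "z \<cdot>\<^sub>v W i \<in> carrier_vec n" using W by simp
      show "(\<phi> (a i i) *\<^sub>v v i) \<bullet>c v i = z * cnj z * (W i \<bullet>c W i)"
        using i zW W[of i] cW[of i] by (simp add: a_def \<phi>1 vi sc mult.assoc)
      show "(\<phi> (a i d) *\<^sub>v v d) \<bullet>c v i = cnj z * (W i \<bullet>c W i)"
        using i W[of i] cW[of i] by (simp add: a_def vi vd sc W_def[symmetric])
      have "\<phi> (adj (y (e i))) *\<^sub>v (z \<cdot>\<^sub>v W i) = z \<cdot>\<^sub>v (\<phi> (adj (y (e i))) *\<^sub>v W i)"
        by (rule mult_mat_vec[OF car[OF adjA[OF y]] W])
      then show "(\<phi> (a d i) *\<^sub>v v i) \<bullet>c v d = z * ((\<phi> (adj (y (e i))) *\<^sub>v W i) \<bullet>c u)"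
        using i u mult_mat_vec_carrier[OF car[OF adjA[OF y]] W, of "e i" i]
        by (simp add: a_def vi vd)
    next
      show "(\<phi> (a d d) *\<^sub>v v d) \<bullet>c v d = u \<bullet>c u" using u by (simp add: a_def v_def \<phi>1)
    qed
    also have "\<dots> = z * cnj z * S + cnj z * S + z * T + vnorm2 u"
      by (simp add: cscalar_prod_self S_def T_def sum.distrib sum_distrib_left)
    finally show ?thesis .
  qed
  \<comment> \<open>The three values are \<open>2 S + T + vnorm2 u\<close>,
    \<open>S + \<i> (T - S) + vnorm2 u\<close> and \<open>vnorm2 u - T\<close>: reality of the first
    two gives \<open>T = S\<close>, and nonnegativity of the third gives the bound.\<close>
  have "Im T = 0" using test[of 1] by (simp add: less_eq_complex_def)
  moreover have "Re T = S" using test[of \<i>] by (simp add: less_eq_complex_def)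
  ultimately have "S \<le> vnorm2 u" using test[of "-1"] by (simp add: less_eq_complex_def)
  moreover have "S = (\<Sum>j\<in>UNIV. vnorm2 (\<phi> (y j) *\<^sub>v u))"
    unfolding S_def W_def by (rule sum.reindex_bij_betw[OF e])
  ultimately show ?thesis by simp
qed

section \<open>The compact perturbation and the two inclusions of matrix ranges\<close>

lemma op_system_subset:
  assumes "\<And>j. x j \<in> A" "cstar_subalgebra A"
  shows "op_system x \<subseteq> A"
  unfolding op_system_def
proof (rule op_space.span_minimal)
  show "insert id_blinfun (range x \<union> range (\<lambda>j. adj (x j))) \<subseteq> A"
    using assms by (auto simp: cstar_subalgebra_def)
  have zero: "(0 :: opr) = 0 *\<^sub>O id_blinfun" by (rule blinfun_eqI) (simp add: scaleC_simps)
  have "0 \<in> A" using assms(2) unfolding cstar_subalgebra_def by (subst zero) blast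
  then show "op_space.subspace A"
    using assms(2) by (auto simp: op_space.subspace_def cstar_subalgebra_def)
qed

lemma op_system_member: "x j \<in> op_system x"
  unfolding op_system_def by (rule op_space.span_base) simp

text \<open>Positivity of an array refers to the Hilbert space and not to the algebra, so it means
  the same in \<open>A'\<close> as in \<open>A\<close>.\<close>

lemma ucp_subset: "ucp A n \<phi> \<Longrightarrow> A' \<subseteq> A \<Longrightarrow> ucp A' n \<phi>"
  unfolding ucp_def by (simp add: subset_iff)

lemma oper_algebra_sum:
  assumes C: "oper_algebra C" and f: "\<And>i. i \<in> I \<Longrightarrow> f i \<in> C"
  shows "(\<Sum>i\<in>I. f i) \<in> C"
proof -
  have "0 \<in> C" using oper_algebraD(5)[OF C oper_algebraD(2)[OF C], of 0] by simp
  then show ?thesis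
    using f by (induction I rule: infinite_finite_induct) (auto intro: oper_algebraD(3)[OF C])
qed

lemma smith_ward_property_OH_Ball:
  fixes x :: "'d::finite \<Rightarrow> opr"
  assumes x: "\<And>j. x j \<in> \<bbbB>" and ess: "ess_matrix_range x = OH_Ball"
  shows "smith_ward_property x"
proof -
  define C where "C = cstar (op_system x)"
  have osB: "op_system x \<subseteq> \<bbbB>" by (rule op_system_subset[OF x cstar_subalgebra_bounded_ops])
  have C: "cstar_subalgebra C" unfolding C_def by (rule cstar_subalgebra_cstar[OF osB])
  have CB: "C \<subseteq> \<bbbB>" using C by (simp add: cstar_subalgebra_def)
  have xC: "x j \<in> C" for j unfolding C_def using cstar_subset op_system_member by (rule subsetD)
  have adjC: "adj T \<in> C" if "T \<in> C" for T using C that by (simp add: cstar_subalgebra_def)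
  note oa = cstar_subalgebra_oper_algebra[OF C]
  note oC = oper_algebraD[OF oa]
  define A where "A = (\<Sum>j\<in>UNIV. adj (x j) o\<^sub>L x j) - id_blinfun"
  have AC: "A \<in> C" unfolding A_def by (intro oC oper_algebra_sum[OF oa] adjC xC)
  have Aap: "A h = (\<Sum>j\<in>UNIV. adj (x j) (x j h)) - h" for h
    by (simp add: A_def blinfun.diff_left blinfun.sum_left)
  have form: "cinner (A h) k = (\<Sum>j\<in>UNIV. cinner (x j h) (x j k)) - cinner h k" for h k
    by (simp add: Aap cinner_simps adj_props(2)[OF x])
  have symA: "symm_op A"
  proof (rule symm_op_iff_cinner)
    show "A \<in> \<bbbB>" using AC CB by blast
    fix h k
    show "cinner (A h) k = cinner h (A k)"
      by (subst cinner_commute) (simp add: form cinner_commute[symmetric])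
  qed
  have quad: "inner (A h) h = (\<Sum>j\<in>UNIV. (norm (x j h))\<^sup>2) - (norm h)\<^sup>2" for h
    by (simp add: inner_ell2_def form cinner_self)
  obtain R where R: "pos_op R" "pos_op (R - A)" "R o\<^sub>L R = A o\<^sub>L R"
    and Rmem: "\<And>C. oper_algebra C \<Longrightarrow> A \<in> C \<Longrightarrow> R \<in> C"
    by (rule positive_part[OF symA]) (rule that; assumption)
  \<comment> \<open>\<open>positive_part\<close> treats \<open>ell2\<close> as a real Hilbert space;
    complex linearity of \<open>R\<close> comes from \<open>R \<in> C\<close> and
    \<open>C \<subseteq> \<bbbB>\<close>.\<close>
  have RC: "R \<in> C" by (rule Rmem[OF oa AC])
  have RK: "R \<in> \<bbbK>"
  proof (rule compact_positive_part)
    show "R \<in> \<bbbB>" using RC CB by blast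
    fix \<xi> \<delta> assume \<xi>: "weakly_null \<xi>" and \<delta>: "0 < \<delta>"
      and le: "\<And>m. \<delta> \<le> inner (blinfun_apply A (\<xi> m)) (\<xi> m)"
    have "(norm (\<xi> m))\<^sup>2 + \<delta> \<le> (\<Sum>j\<in>UNIV. (norm (x j (\<xi> m)))\<^sup>2)" for m
      using le[of m] by (simp add: quad)
    from column_norm_violation[OF x CB \<xi> \<delta> this] obtain n \<phi> v
      where n: "1 \<le> n" and \<phi>: "ucp C n \<phi>" "\<forall>a\<in>\<bbbK>. \<phi> a = 0\<^sub>m n n" and v: "v \<in> carrier_vec n"
        "vnorm2 v < (\<Sum>j\<in>UNIV. vnorm2 (\<phi> (x j) *\<^sub>v v))" by blast
    have "(n, \<lambda>j. \<phi> (x j)) \<in> ess_matrix_range x"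
      unfolding ess_matrix_range_def C_def[symmetric] using n \<phi> by auto
    then have "(\<Sum>j\<in>UNIV. vnorm2 (\<phi> (x j) *\<^sub>v v)) \<le> vnorm2 v"
      unfolding ess OH_Ball_iff using v(1) by blast
    then show False using v(2) by simp
  qed (use R in auto)
  obtain G :: opr where G: "\<And>h. G h + R (G h) = h" "\<And>h. G h + G (R h) = h"
    and Gmem: "\<And>C. oper_algebra C \<Longrightarrow> R \<in> C \<Longrightarrow> G \<in> C"
    by (rule neumann_inverse[OF R(1)]) (rule that; assumption)
  have GC: "G \<in> C" by (rule Gmem[OF oa RC])
  \<comment> \<open>As \<open>G + G R = 1\<close>, this is \<open>x\<^sub>j (G - 1)\<close>, written
    so that the compact factor \<open>R\<close> is visible.\<close>
  define k where "k j = (-1) *\<^sub>R (x j o\<^sub>L (G o\<^sub>L R))" for j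
  have kC: "k j \<in> C" for j unfolding k_def by (intro oC xC GC RC)
  have kK: "k j \<in> \<bbbK>" for j
  proof (rule compact_opsI_weakly_null)
    show "k j \<in> \<bbbB>" using kC CB by blast
    fix \<xi> assume "weakly_null \<xi>"
    from compact_ops_weakly_null[OF RK this]
    have "(\<lambda>m. - x j (G (R (\<xi> m)))) \<longlonglongrightarrow> - x j (G 0)"
      by (intro tendsto_minus blinfun.tendsto tendsto_const)
    then show "(\<lambda>m. k j (\<xi> m)) \<longlonglongrightarrow> 0" by (simp add: k_def blinfun_simps)
  qed
  define y where "y j = x j + k j" for j
  have yC: "y j \<in> C" for j unfolding y_def by (intro oC xC kC)
  have yap: "y j h = x j (G h)" for j h
  proof -
    have "x j (G h + G (R h)) = x j h" by (simp only: G(2))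
    then show ?thesis by (simp add: y_def k_def blinfun_simps algebra_simps)
  qed
  define D where "D = cstar (op_system y)"
  have osC: "op_system y \<subseteq> C" by (rule op_system_subset[OF yC C])
  have DC: "D \<subseteq> C" unfolding D_def by (rule cstar_minimal[OF osC C])
  have D: "cstar_subalgebra D"
    unfolding D_def using osC CB by (intro cstar_subalgebra_cstar) blast
  have yD: "y j \<in> D" for j unfolding D_def using cstar_subset op_system_member by (rule subsetD)
  have contr: "(\<Sum>j\<in>UNIV. (norm (y j h))\<^sup>2) \<le> (norm h)\<^sup>2" for h
  proof -
    have "inner (G h + A (G h)) (G h) \<le> inner h h"
      by (rule inverse_positive_part_bound[OF R(1,2) G(1)])
    then show ?thesis
      by (simp add: inner_add_left quad yap power2_norm_eq_inner[symmetric])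
  qed
  have "ess_matrix_range x = matrix_range y"
  proof (intro equalityI subsetI)
    fix p assume "p \<in> ess_matrix_range x"
    then obtain n \<phi> where p: "p = (n, \<lambda>j. \<phi> (x j))" and n: "1 \<le> n" and \<phi>: "ucp C n \<phi>"
      and null: "\<forall>a\<in>C \<inter> \<bbbK>. \<phi> a = 0\<^sub>m n n"
      unfolding ess_matrix_range_def C_def[symmetric] by auto
    \<comment> \<open>The vanishing condition speaks of \<open>C \<inter> \<bbbK>\<close>; it
      reaches \<open>k j\<close> because \<open>k j\<close> lies in \<open>C\<close> as well as in
      \<open>\<bbbK>\<close>.\<close>
    have "\<phi> (y j) = \<phi> (x j)" for j
    proof -
      have "\<phi> (y j) = \<phi> (x j) + \<phi> (k j)" using \<phi> xC kC unfolding ucp_def y_def by blast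
      moreover have "\<phi> (k j) = 0\<^sub>m n n" using null kC kK by blast
      moreover have "\<phi> (x j) \<in> carrier_mat n n" using \<phi> xC unfolding ucp_def by blast
      ultimately show ?thesis by simp
    qed
    then have "p = (n, \<lambda>j. \<phi> (y j))" by (simp add: p)
    then show "p \<in> matrix_range y"
      unfolding matrix_range_def D_def[symmetric] using n ucp_subset[OF \<phi> DC] by auto
  next
    fix p assume "p \<in> matrix_range y"
    then obtain n \<phi> where p: "p = (n, \<lambda>j. \<phi> (y j))" and n: "1 \<le> n" and \<phi>: "ucp D n \<phi>"
      unfolding matrix_range_def D_def[symmetric] by auto
    have "\<phi> (y j) \<in> carrier_mat n n" for j using \<phi> yD unfolding ucp_def by blast
    \<comment> \<open>The point lies in the ball, and \<open>ess\<close> puts all of the ball into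
      the essential range; the map that realizes the point there may have no relation to
      \<open>\<phi>\<close>.\<close>
    then show "p \<in> ess_matrix_range x"
      unfolding ess p OH_Ball_iff using n ucp_column_contraction[OF \<phi> D yD contr] by blast
  qed
  then show ?thesis
    unfolding smith_ward_property_def using kK by (intro exI[of _ k]) (simp add: y_def[abs_def])
qed

theorem theorem3p4:
  shows "smith_ward_geometry (OH_Ball :: ('d::finite) graded)"
  unfolding smith_ward_geometry_def
  using compact_matrix_convex_OH_Ball smith_ward_property_OH_Ball by blast

end
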